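(* Let $X$ be an SMD random variable such that $K_{2n}(X)K_{2n+2}(X)<0$ for every integer $n\ge1$. If $Y$ is a centred real random variable admitting moments of all orders such that $K_4(Y)K_4(X)>0$ and $\mathit{mmse}(X,s)=\mathit{mmse}(Y,s)$ for all $s>0$, then $X$ and $Y$ have the same distribution.
   Context: For a real random variable $X$ with moments of all orders, its cumulants are $K_n(X)=(-i)^n(\ln\varphi_X)^{(n)}(0)$, $\varphi_X$ the characteristic function. $X$ is called SMD if $X$ and $-X$ have the same law, $X$ has moments of all orders, and any random variable $Y$ with $\mathbb{E}[Y^p]=\mathbb{E}[X^p]$ for all $p\ge1$ has the same law as $X$. For $s>0$, $\mathit{mmse}(X,s)=\mathbb{E}[(X-\mathbb{E}[X\mid Y_s])^2]$ where $Y_s=\sqrt{s}X+N$ and $N$ is a standard Gaussian independent of $X$. *)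

theory Defs
  imports "HOL-Probability.Probability"
begin

text \<open>All notions are defined on the law (a real measure) of a random variable.\<close>

definition nth_vderiv :: "nat \<Rightarrow> (real \<Rightarrow> complex) \<Rightarrow> real \<Rightarrow> complex" where
  "nth_vderiv n f = ((\<lambda>g t. vector_derivative g (at t)) ^^ n) f"

text \<open>Cumulant K_n = (-i)^n (ln phi)^(n)(0), phi the characteristic function
  (real-valued for real laws with moments of all orders; we take the real part).\<close>
definition cumulant :: "real measure \<Rightarrow> nat \<Rightarrow> real" where
  "cumulant \<mu> n = Re ((- \<i>) ^ n * nth_vderiv n (\<lambda>t. Ln (char \<mu> t)) 0)"

definition real_law :: "real measure \<Rightarrow> bool" where
  "real_law \<mu> \<longleftrightarrow> prob_space \<mu> \<and> sets \<mu> = sets borel"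

definition all_moments :: "real measure \<Rightarrow> bool" where
  "all_moments \<mu> \<longleftrightarrow> (\<forall>n::nat. integrable \<mu> (\<lambda>x. x ^ n))"

definition SMD :: "real measure \<Rightarrow> bool" where
  "SMD \<mu> \<longleftrightarrow> real_law \<mu> \<and> distr \<mu> borel uminus = \<mu> \<and> all_moments \<mu> \<and>
     (\<forall>\<nu>. real_law \<nu> \<and> (\<forall>p::nat\<ge>1. integrable \<nu> (\<lambda>x. x ^ p) \<and>
            (\<integral>x. x ^ p \<partial>\<nu>) = (\<integral>x. x ^ p \<partial>\<mu>)) \<longrightarrow> \<nu> = \<mu>)"

text \<open>mmse(X,s) = E[(X - E[X | Y_s])^2] with Y_s = sqrt s X + N, N standard Gaussian
  independent of X; realised on the product space law(X) \<otimes> N(0,1).\<close>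
definition mmse :: "real measure \<Rightarrow> real \<Rightarrow> real" where
  "mmse \<mu> s =
     (let P = \<mu> \<Otimes>\<^sub>M std_normal_distribution;
          Ys = (\<lambda>z. sqrt s * fst z + snd z);
          F = vimage_algebra (space P) Ys borel
      in \<integral>z. (fst z - real_cond_exp P F fst z)\<^sup>2 \<partial>P)"

end

theory Submission
  imports Defs "HOL-Library.Landau_Symbols"
begin

text \<open>
  The density of \<open>\<epsilon> X + N\<close> relative to that of \<open>N\<close> has the formal expansion
  \<open>W = \<Sum> E X\<^sup>n \<epsilon>\<^sup>n He\<^sub>n / n!\<close>, and \<open>V = W' / W\<close> represents \<open>\<epsilon> E (X | \<epsilon> X + N)\<close>. The truncations of \<open>V\<close> are
  polynomial estimators whose error is computed exactly from the moments, and they are optimal up to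
  \<open>O(\<epsilon>\<^sup>2\<^sup>M)\<close>; hence \<open>\<epsilon>\<^sup>2 mmse(X, \<epsilon>\<^sup>2)\<close> has the asymptotic expansion of
  \<open>\<epsilon>\<^sup>2 E X\<^sup>2 - E (V\<^sup>2 W)\<close>, whose coefficients therefore agree for \<open>X\<close> and \<open>Y\<close>.

  Suppose the moments of order below \<open>k\<close> agree and let \<open>d\<close> be the difference of the \<open>k\<close>-th ones. The coefficient of
  \<open>\<epsilon>\<^sup>2\<^sup>k\<close> gives \<open>d (2 K\<^sub>k + d) = 0\<close>, so \<open>d = 0\<close> or the \<open>k\<close>-th cumulant changes sign. For odd \<open>k\<close> we have
  \<open>K\<^sub>k = 0\<close>, and for \<open>k = 4\<close> a change of sign is excluded by assumption. For even \<open>k \<ge> 6\<close> the next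
  coefficient, that of \<open>\<epsilon>\<^sup>2\<^sup>k\<^sup>+\<^sup>2\<close>, would be a nonnegative number plus a positive combination of the products
  \<open>K\<^sub>i K\<^sub>j K\<^sub>k\<close> with \<open>i + j = k + 2\<close> and \<open>i, j \<ge> 4\<close> even, all of which are positive because the even cumulants of \<open>X\<close>
  alternate in sign.
\<close>

subsection \<open>Gaussian expectation of polynomials\<close>

abbreviation gaussian :: "real measure" where
  "gaussian \<equiv> std_normal_distribution"

definition gauss_ex :: "real poly \<Rightarrow> real" where
  "gauss_ex p = (\<integral>y. poly p y \<partial>gaussian)"

lemma integrable_gaussian_poly: "integrable gaussian (poly p)"
proof -
  have "integrable gaussian (\<lambda>y. \<Sum>i\<le>degree p. coeff p i * y ^ i)"
    by (intro Bochner_Integration.integrable_sum integrable_mult_right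
          integrable_std_normal_distribution_moment)
  then show ?thesis
    by (simp add: poly_altdef[abs_def])
qed

lemma gauss_ex_0 [simp]: "gauss_ex 0 = 0"
  by (simp add: gauss_ex_def)

lemma gauss_ex_add: "gauss_ex (p + q) = gauss_ex p + gauss_ex q"
  by (simp add: gauss_ex_def integrable_gaussian_poly)

lemma gauss_ex_diff: "gauss_ex (p - q) = gauss_ex p - gauss_ex q"
  by (simp add: gauss_ex_def integrable_gaussian_poly)

lemma gauss_ex_smult: "gauss_ex (smult c p) = c * gauss_ex p"
  by (simp add: gauss_ex_def)

lemma gauss_ex_sum: "gauss_ex (\<Sum>i\<in>A. f i) = (\<Sum>i\<in>A. gauss_ex (f i))"
  by (induction A rule: infinite_finite_induct) (simp_all add: gauss_ex_add)

lemma gauss_ex_const [simp]: "gauss_ex [:c:] = c"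
  using std_normal_distribution_even_moments[of 0] by (simp add: gauss_ex_def)

lemma gaussian_moment_Suc_Suc:
  "(\<integral>y. y ^ Suc (Suc n) \<partial>gaussian) = real (Suc n) * (\<integral>y. y ^ n \<partial>gaussian)"
proof (cases "even n")
  case True
  then obtain k where n: "n = 2 * k" by (auto elim: evenE)
  have "(\<integral>y. y ^ (2 * Suc k) \<partial>gaussian) = fact (2 * Suc k) / (2 ^ Suc k * fact (Suc k))"
    by (rule std_normal_distribution_even_moments(1))
  also have "\<dots> = real (Suc n) * (fact (2 * k) / (2 ^ k * fact k))"
  proof -
    have "real (Suc k) \<noteq> 0" by simp
    then show ?thesis
      unfolding n by (simp add: divide_simps del: of_nat_Suc) (simp add: algebra_simps)
  qed
  also have "fact (2 * k) / (2 ^ k * fact k) = (\<integral>y. y ^ (2 * k) \<partial>gaussian)"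
    by (rule std_normal_distribution_even_moments(1)[symmetric])
  finally show ?thesis by (simp add: n)
next
  case False
  then show ?thesis
    using integral_std_normal_distribution_moment_odd[of n]
      integral_std_normal_distribution_moment_odd[of "Suc (Suc n)"] by simp
qed

lemma gauss_ex_pderiv_monom: "gauss_ex (pderiv (monom c n)) = gauss_ex ([:0, 1:] * monom c n)"
proof (cases n)
  case 0
  then show ?thesis
    using integral_std_normal_distribution_moment_odd[of 1]
    by (simp add: gauss_ex_def pderiv_monom poly_monom mult.commute)
next
  case (Suc k)
  have "gauss_ex (pderiv (monom c n)) = real n * c * (\<integral>y. y ^ k \<partial>gaussian)"
    unfolding gauss_ex_def pderiv_monom poly_monom Suc
    by (subst integral_mult_right_zero[symmetric]) simp
  also have "\<dots> = c * (\<integral>y. y ^ Suc (Suc k) \<partial>gaussian)"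
    unfolding gaussian_moment_Suc_Suc Suc by simp
  also have "\<dots> = gauss_ex ([:0, 1:] * monom c n)"
  proof -
    have "poly ([:0, 1:] * monom c (Suc k)) = (\<lambda>y. c * y ^ Suc (Suc k))"
      by (auto simp: poly_monom fun_eq_iff)
    then show ?thesis
      unfolding gauss_ex_def Suc by (simp only: integral_mult_right_zero)
  qed
  finally show ?thesis .
qed

lemma gauss_ex_pderiv: "gauss_ex (pderiv p) = gauss_ex ([:0, 1:] * p)"
proof -
  have "pderiv (\<Sum>i\<le>degree p. monom (coeff p i) i) = (\<Sum>i\<le>degree p. pderiv (monom (coeff p i) i))"
    using higher_pderiv_sum[of 1] by simp
  then have "gauss_ex (pderiv (\<Sum>i\<le>degree p. monom (coeff p i) i))
      = gauss_ex ([:0, 1:] * (\<Sum>i\<le>degree p. monom (coeff p i) i))"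
    by (simp only: sum_distrib_left gauss_ex_sum gauss_ex_pderiv_monom)
  then show ?thesis
    by (simp only: poly_as_sum_of_monoms)
qed

subsection \<open>Hermite polynomials\<close>

text \<open>The normalisation is \<open>He\<^sub>n / n!\<close>, i.e. the coefficients of \<open>exp (t y - t\<^sup>2 / 2)\<close> in \<open>t\<close>.\<close>

primrec hermite :: "nat \<Rightarrow> real poly" where
  "hermite 0 = 1"
| "hermite (Suc n) = smult (1 / real (Suc n)) ([:0, 1:] * hermite n - pderiv (hermite n))"

declare hermite.simps(2) [simp del]

lemma smult_hermite_Suc:
  "smult (real (Suc n)) (hermite (Suc n)) = [:0, 1:] * hermite n - pderiv (hermite n)"
  by (simp add: hermite.simps(2) del: of_nat_Suc)

lemma hermite_1: "hermite (Suc 0) = [:0, 1:]"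
  by (simp add: hermite.simps(2))

lemma pderiv_hermite_Suc: "pderiv (hermite (Suc n)) = hermite n"
proof (induction n)
  case 0
  show ?case by (simp add: hermite_1 pderiv_pCons)
next
  case (Suc n)
  have "smult (real (Suc (Suc n))) (pderiv (hermite (Suc (Suc n)))) =
      pderiv ([:0, 1:] * hermite (Suc n) - pderiv (hermite (Suc n)))"
    unfolding smult_hermite_Suc[symmetric] pderiv_smult ..
  also have "\<dots> = hermite (Suc n) + ([:0, 1:] * hermite n - pderiv (hermite n))"
    unfolding pderiv_diff pderiv_mult Suc by (simp add: pderiv_pCons)
  also have "\<dots> = smult (real (Suc (Suc n))) (hermite (Suc n))"
    unfolding smult_hermite_Suc[symmetric] of_nat_Suc[of "Suc n"] smult_add_left[of 1]
    by (simp only: smult_1_left)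
  finally show ?case
    by (metis of_nat_eq_0_iff nat.simps(3) smult_cancel)
qed

lemma higher_pderiv_hermite:
  "(pderiv ^^ i) (hermite n) = (if i \<le> n then hermite (n - i) else 0)"
proof (induction i)
  case (Suc i)
  show ?case
  proof (cases "i < n")
    case True
    then obtain m where "n - i = Suc m" "n - Suc i = m" by (metis Suc_diff_Suc)
    with True Suc show ?thesis by (simp add: pderiv_hermite_Suc)
  qed (use Suc in auto)
qed simp

lemma hermite_ode:
  "[:0, 1:] * pderiv (hermite n) - pderiv (pderiv (hermite n)) = smult (real n) (hermite n)"
proof (cases n)
  case (Suc m)
  show ?thesis
    unfolding Suc pderiv_hermite_Suc smult_hermite_Suc ..
qed simp

lemma coeff_hermite_eq_0: "n < i \<Longrightarrow> coeff (hermite n) i = 0"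
proof (induction n arbitrary: i)
  case (Suc n)
  then obtain j where "i = Suc j" "n < j" by (cases i) auto
  with Suc.IH show ?case by (simp add: hermite.simps(2) coeff_pderiv)
qed (simp add: coeff_eq_0)

lemma degree_hermite_le: "degree (hermite n) \<le> n"
  by (rule degree_le) (simp add: coeff_hermite_eq_0)

lemma coeff_hermite_self: "coeff (hermite n) n = 1 / fact n"
proof (induction n)
  case (Suc n)
  then show ?case by (simp add: hermite.simps(2) coeff_pderiv coeff_hermite_eq_0)
qed simp

lemma gauss_ex_hermite_Suc_mult:
  "real (Suc j) * gauss_ex (hermite (Suc j) * p) = gauss_ex (hermite j * pderiv p)"
proof -
  have "real (Suc j) * gauss_ex (hermite (Suc j) * p)
      = gauss_ex (([:0, 1:] * hermite j - pderiv (hermite j)) * p)"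
    unfolding smult_hermite_Suc[symmetric] mult_smult_left gauss_ex_smult ..
  also have "\<dots> = gauss_ex ([:0, 1:] * (hermite j * p)) - gauss_ex (pderiv (hermite j) * p)"
    by (simp only: gauss_ex_diff[symmetric] algebra_simps)
  also have "\<dots> = gauss_ex (hermite j * pderiv p)"
    unfolding gauss_ex_pderiv[symmetric] pderiv_mult gauss_ex_add by (simp add: mult.commute)
  finally show ?thesis .
qed

lemma gauss_ex_higher_pderiv: "gauss_ex ((pderiv ^^ j) p) = fact j * gauss_ex (hermite j * p)"
proof (induction j arbitrary: p)
  case (Suc j)
  have "gauss_ex ((pderiv ^^ Suc j) p) = fact j * gauss_ex (hermite j * pderiv p)"
    unfolding funpow_Suc_right o_apply Suc ..
  also have "\<dots> = fact j * (real (Suc j) * gauss_ex (hermite (Suc j) * p))"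
    unfolding gauss_ex_hermite_Suc_mult ..
  also have "\<dots> = fact (Suc j) * gauss_ex (hermite (Suc j) * p)"
    unfolding fact_Suc by (simp only: mult_ac)
  finally show ?case .
qed simp

lemma gauss_ex_hermite_mult_ode:
  "gauss_ex (hermite j * ([:0, 1:] * pderiv p - pderiv (pderiv p))) = real j * gauss_ex (hermite j * p)"
proof -
  have "gauss_ex (hermite j * ([:0, 1:] * pderiv p - pderiv (pderiv p)))
      = gauss_ex ([:0, 1:] * (hermite j * pderiv p)) - gauss_ex (hermite j * pderiv (pderiv p))"
    by (simp only: gauss_ex_diff[symmetric] algebra_simps)
  also have "\<dots> = gauss_ex (pderiv (hermite j) * pderiv p)"
    unfolding gauss_ex_pderiv[symmetric] pderiv_mult gauss_ex_add by (simp add: mult.commute)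
  also have "\<dots> = real j * gauss_ex (hermite j * p)"
  proof (cases j)
    case (Suc i)
    show ?thesis unfolding Suc pderiv_hermite_Suc gauss_ex_hermite_Suc_mult ..
  qed simp
  finally show ?thesis .
qed

lemma gauss_ex_hermite_eq_coeff: "degree p \<le> j \<Longrightarrow> gauss_ex (hermite j * p) = coeff p j"
proof (induction j arbitrary: p)
  case 0
  then obtain a where "p = [:a:]" by (metis degree_0_id le_zero_eq)
  then show ?case by simp
next
  case (Suc j)
  have "real (Suc j) * gauss_ex (hermite (Suc j) * p) = coeff (pderiv p) j"
    unfolding gauss_ex_hermite_Suc_mult using Suc by (simp add: degree_pderiv)
  then show ?case unfolding coeff_pderiv by simp
qed

lemma gauss_ex_hermite_eq_0: "degree p < j \<Longrightarrow> gauss_ex (hermite j * p) = 0"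
  using gauss_ex_hermite_eq_coeff[of p j] by (simp add: coeff_eq_0)

lemma gauss_ex_hermite_orthogonal:
  "gauss_ex (hermite m * hermite n) = (if m = n then 1 / fact n else 0)"
proof -
  consider "m = n" | "n < m" | "m < n" by linarith
  then show ?thesis
  proof cases
    case 1
    then show ?thesis
      using gauss_ex_hermite_eq_coeff[OF degree_hermite_le] by (simp add: coeff_hermite_self)
  next
    case 2
    then show ?thesis
      using gauss_ex_hermite_eq_0[of "hermite n" m] degree_hermite_le[of n] by simp
  next
    case 3
    then show ?thesis
      using gauss_ex_hermite_eq_0[of "hermite m" n] degree_hermite_le[of m] by (simp add: mult.commute)
  qed
qed

lemma gauss_ex_mult_hermite_Suc:
  "gauss_ex ([:0, 1:] * (hermite n * hermite (Suc n))) = 1 / fact n"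
proof -
  have "gauss_ex ([:0, 1:] * (hermite n * hermite (Suc n)))
      = gauss_ex (pderiv (hermite n) * hermite (Suc n)) + gauss_ex (hermite n * hermite n)"
    unfolding gauss_ex_pderiv[symmetric] pderiv_mult pderiv_hermite_Suc gauss_ex_add by (simp add: mult.commute)
  also have "gauss_ex (pderiv (hermite n) * hermite (Suc n)) = 0"
    using gauss_ex_hermite_eq_0[of "pderiv (hermite n)" "Suc n"] degree_hermite_le[of n]
    by (simp add: degree_pderiv mult.commute)
  finally show ?thesis by (simp add: gauss_ex_hermite_orthogonal)
qed

lemma gauss_ex_hermite_2_mult_square:
  "gauss_ex (hermite 2 * (hermite n * hermite n)) = real n / fact n"
proof (cases n)
  case 0
  then show ?thesis using gauss_ex_hermite_orthogonal[of 2 0] by simp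
next
  case (Suc m)
  let ?h = "hermite (Suc m)"
  have "2 * gauss_ex (hermite 2 * (?h * ?h)) = gauss_ex (pderiv (pderiv (?h * ?h)))"
    using gauss_ex_higher_pderiv[of 2 "?h * ?h"] by (simp add: numeral_2_eq_2)
  also have "pderiv (pderiv (?h * ?h)) = smult 2 (hermite m * hermite m + ?h * pderiv (hermite m))"
    by (simp add: pderiv_mult pderiv_hermite_Suc pderiv_add smult_add_right algebra_simps
        flip: mult_2 numeral_mult_conv_smult)
  also have "gauss_ex \<dots> = 2 / fact m"
    using gauss_ex_hermite_eq_0[of "pderiv (hermite m)" "Suc m"] degree_hermite_le[of m]
    by (simp add: gauss_ex_smult gauss_ex_add gauss_ex_hermite_orthogonal degree_pderiv)
  finally show ?thesis by (simp add: Suc)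
qed

subsection \<open>Power series with polynomial coefficients\<close>

definition yderiv :: "real poly fps \<Rightarrow> real poly fps" where
  "yderiv A = Abs_fps (\<lambda>n. pderiv (fps_nth A n))"

lemma yderiv_nth [simp]: "fps_nth (yderiv A) n = pderiv (fps_nth A n)"
  by (simp add: yderiv_def)

lemma higher_yderiv_nth: "fps_nth ((yderiv ^^ i) A) n = (pderiv ^^ i) (fps_nth A n)"
  by (induction i) simp_all

lemma yderiv_add: "yderiv (A + B) = yderiv A + yderiv B"
  by (rule fps_ext) (simp add: pderiv_add)

lemma yderiv_diff: "yderiv (A - B) = yderiv A - yderiv B"
  by (rule fps_ext) (simp add: pderiv_diff)

lemma yderiv_mult: "yderiv (A * B) = yderiv A * B + A * yderiv B"
  by (rule fps_ext)
    (simp add: fps_mult_nth higher_pderiv_sum[of 1, simplified] pderiv_mult sum.distrib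
      mult.commute[of "pderiv _"])

lemma fps_XD_yderiv: "fps_XD (yderiv A) = yderiv (fps_XD A)"
  by (rule fps_ext) (simp add: pderiv_mult)

lemma fps_XD_mult: "fps_XD (A * B) = fps_XD A * B + A * fps_XD (B :: 'a::comm_ring_1 fps)"
  by (simp add: fps_XD_def algebra_simps)

abbreviation yvar :: "real poly fps" where
  "yvar \<equiv> fps_const [:0, 1:]"

lemma yderiv_yvar [simp]: "yderiv yvar = 1"
  by (rule fps_ext) (simp add: pderiv_pCons)

definition gauss_fps :: "real poly fps \<Rightarrow> real fps" where
  "gauss_fps A = Abs_fps (\<lambda>n. gauss_ex (fps_nth A n))"

lemma gauss_fps_nth [simp]: "fps_nth (gauss_fps A) n = gauss_ex (fps_nth A n)"
  by (simp add: gauss_fps_def)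

lemma gauss_fps_add: "gauss_fps (A + B) = gauss_fps A + gauss_fps B"
  by (rule fps_ext) (simp add: gauss_ex_add)

lemma gauss_fps_diff: "gauss_fps (A - B) = gauss_fps A - gauss_fps B"
  by (rule fps_ext) (simp add: gauss_ex_diff)

definition graded :: "real poly fps \<Rightarrow> bool" where
  "graded A \<longleftrightarrow> (\<forall>n. degree (fps_nth A n) \<le> n)"

definition top_coeffs :: "real poly fps \<Rightarrow> real fps" where
  "top_coeffs A = Abs_fps (\<lambda>n. coeff (fps_nth A n) n)"

lemma top_coeffs_nth [simp]: "fps_nth (top_coeffs A) n = coeff (fps_nth A n) n"
  by (simp add: top_coeffs_def)

lemma graded_mult:
  assumes "graded A" "graded B"
  shows "graded (A * B)"
  unfolding graded_def fps_mult_nth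
proof (intro allI degree_sum_le)
  fix n i :: nat assume "i \<in> {0..n}"
  moreover have "degree (fps_nth A i) \<le> i" "degree (fps_nth B (n - i)) \<le> n - i"
    using assms by (auto simp: graded_def)
  ultimately show "degree (fps_nth A i * fps_nth B (n - i)) \<le> n"
    using degree_mult_le[of "fps_nth A i" "fps_nth B (n - i)"] by auto
qed simp

lemma coeff_mult_add_degree_le:
  fixes p q :: "'a::comm_semiring_0 poly"
  assumes "degree p \<le> i" "degree q \<le> j"
  shows "coeff (p * q) (i + j) = coeff p i * coeff q j"
proof -
  have "coeff p k * coeff q (i + j - k) = (if k = i then coeff p i * coeff q j else 0)" for k
    using assms by (cases k i rule: linorder_cases) (simp_all add: coeff_eq_0)
  then show ?thesis
    by (simp add: coeff_mult)
qed

lemma top_coeffs_mult: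
  assumes "graded A" "graded B"
  shows "top_coeffs (A * B) = top_coeffs A * top_coeffs B"
proof (rule fps_ext)
  fix n
  have "coeff (fps_nth A i * fps_nth B (n - i)) n = coeff (fps_nth A i) i * coeff (fps_nth B (n - i)) (n - i)"
    if "i \<in> {0..n}" for i
    using coeff_mult_add_degree_le[of "fps_nth A i" i "fps_nth B (n - i)" "n - i"] assms that
    by (simp add: graded_def)
  then show "fps_nth (top_coeffs (A * B)) n = fps_nth (top_coeffs A * top_coeffs B) n"
    by (simp add: fps_mult_nth coeff_sum)
qed

lemma fps_mult_nth_solve:
  fixes W U :: "'a::comm_ring_1 fps"
  shows "fps_nth W 0 * fps_nth U n = fps_nth (W * U) n - (\<Sum>i = 1..n. fps_nth W i * fps_nth U (n - i))"
  by (simp add: fps_mult_nth sum.atLeast_Suc_atMost)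

lemma fps_nth_quotient:
  fixes W :: "'a::comm_ring_1 fps"
  assumes "fps_nth W 0 = 1" "W * U = B"
  shows "fps_nth U n = fps_nth B n - (\<Sum>i = 1..n. fps_nth W i * fps_nth U (n - i))"
  using fps_mult_nth_solve[of W U n] assms by simp

lemma graded_quotient:
  assumes "graded W" "graded B" "fps_nth W 0 = 1" "W * U = B"
  shows "graded U"
  unfolding graded_def
proof
  fix n
  show "degree (fps_nth U n) \<le> n"
  proof (induction n rule: less_induct)
    case (less n)
    have "degree (\<Sum>i = 1..n. fps_nth W i * fps_nth U (n - i)) \<le> n"
    proof (rule degree_sum_le)
      fix i assume i: "i \<in> {1..n}"
      moreover have "degree (fps_nth W i) \<le> i" "degree (fps_nth U (n - i)) \<le> n - i"
        using assms(1) less i by (auto simp: graded_def)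
      ultimately show "degree (fps_nth W i * fps_nth U (n - i)) \<le> n"
        using degree_mult_le[of "fps_nth W i" "fps_nth U (n - i)"] by auto
    qed simp
    moreover have "degree (fps_nth B n) \<le> n"
      using assms(2) by (simp add: graded_def)
    ultimately show ?case
      unfolding fps_nth_quotient[OF assms(3,4), of n] by (intro degree_diff_le)
  qed
qed

subsection \<open>Formal expansion of the conditional mean\<close>

text \<open>With \<open>a\<^sub>n = E X\<^sup>n\<close> and the formal variable standing for \<open>\<epsilon>\<close>, \<open>noisy_density a\<close> is the density of
  \<open>\<epsilon> X + N\<close> relative to that of \<open>N\<close>, and \<open>cond_mean a\<close>, its logarithmic derivative, is
  \<open>\<epsilon> E (X | \<epsilon> X + N = y)\<close>. The \<open>i\<close>-th derivative of the former is the density weighted with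
  \<open>E ((\<epsilon> X)\<^sup>i | \<epsilon> X + N = y)\<close>, so \<open>mmse_fps a\<close> is the expectation of the conditional variance of \<open>\<epsilon> X\<close>.\<close>

definition noisy_density :: "(nat \<Rightarrow> real) \<Rightarrow> real poly fps" where
  "noisy_density a = Abs_fps (\<lambda>n. smult (a n) (hermite n))"

definition cond_mean :: "(nat \<Rightarrow> real) \<Rightarrow> real poly fps" where
  "cond_mean a = yderiv (noisy_density a) * fps_right_inverse (noisy_density a) 1"

definition mmse_fps :: "(nat \<Rightarrow> real) \<Rightarrow> real fps" where
  "mmse_fps a = gauss_fps (yderiv (yderiv (noisy_density a)) - noisy_density a * (cond_mean a * cond_mean a))"

lemma noisy_density_nth [simp]: "fps_nth (noisy_density a) n = smult (a n) (hermite n)"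
  by (simp add: noisy_density_def)

lemma noisy_density_diff: "noisy_density b - noisy_density a = noisy_density (\<lambda>n. b n - a n)"
  by (rule fps_ext) (simp add: smult_diff_left)

lemma graded_noisy_density: "graded (noisy_density a)"
  unfolding graded_def noisy_density_nth
  by (meson degree_hermite_le degree_smult_le order_trans)

lemma shift_yderiv_noisy_density_nth:
  "fps_nth (fps_shift 1 (yderiv (noisy_density a))) n = smult (a (Suc n)) (hermite n)"
  by (simp add: pderiv_smult pderiv_hermite_Suc)

lemma higher_yderiv_noisy_density_nth:
  "fps_nth ((yderiv ^^ i) (noisy_density a)) n = (if i \<le> n then smult (a n) (hermite (n - i)) else 0)"
  by (simp add: higher_yderiv_nth higher_pderiv_smult higher_pderiv_hermite)

lemma gauss_fps_yderiv2_noisy_density: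
  "fps_nth (gauss_fps (yderiv (yderiv (noisy_density a)))) n = (if n = 2 then a 2 else 0)"
  using higher_yderiv_noisy_density_nth[of 2 a n] gauss_ex_hermite_orthogonal[of 0 "n - 2"]
  by (auto simp: numeral_2_eq_2 gauss_ex_smult)

lemma fps_XD_noisy_density:
  "fps_XD (noisy_density a) = yvar * yderiv (noisy_density a) - yderiv (yderiv (noisy_density a))"
proof (rule fps_ext)
  fix n
  have "fps_nth (yvar * yderiv (noisy_density a) - yderiv (yderiv (noisy_density a))) n
      = smult (a n) ([:0, 1:] * pderiv (hermite n) - pderiv (pderiv (hermite n)))"
    by (simp add: pderiv_smult smult_diff_right)
  also have "\<dots> = fps_nth (fps_XD (noisy_density a)) n"
    unfolding hermite_ode by (simp add: of_nat_poly mult.commute)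
  finally show "fps_nth (fps_XD (noisy_density a)) n
      = fps_nth (yvar * yderiv (noisy_density a) - yderiv (yderiv (noisy_density a))) n" ..
qed

definition mgf :: "(nat \<Rightarrow> real) \<Rightarrow> real fps" where
  "mgf a = Abs_fps (\<lambda>n. a n / fact n)"

lemma mgf_nth [simp]: "fps_nth (mgf a) n = a n / fact n"
  by (simp add: mgf_def)

text \<open>The derivative of the cumulant generating function: its \<open>n\<close>-th coefficient is \<open>K\<^sub>n\<^sub>+\<^sub>1 / n!\<close>.\<close>

definition cumulant_fps :: "(nat \<Rightarrow> real) \<Rightarrow> real fps" where
  "cumulant_fps a = fps_deriv (mgf a) / mgf a"

context
  fixes a :: "nat \<Rightarrow> real"
  assumes a0: "a 0 = 1"
begin

lemma mgf_mult_cumulant_fps: "mgf a * cumulant_fps a = fps_deriv (mgf a)"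
proof -
  have "fps_nth (mgf a) 0 \<noteq> 0" by (simp add: a0)
  then show ?thesis
    by (simp add: cumulant_fps_def fps_divide_unit mult.left_commute inverse_mult_eq_1')
qed

lemma cumulant_fps_nth:
  "fps_nth (cumulant_fps a) n
     = a (Suc n) / fact n - (\<Sum>i = 1..n. a i / fact i * fps_nth (cumulant_fps a) (n - i))"
  using fps_nth_quotient[OF _ mgf_mult_cumulant_fps, of n] by (simp add: a0 divide_simps)

lemma noisy_density_mult_right_inverse: "noisy_density a * fps_right_inverse (noisy_density a) 1 = 1"
  by (rule fps_right_inverse) (simp add: a0)

lemma noisy_density_nonzero: "noisy_density a \<noteq> 0"
  using noisy_density_mult_right_inverse by auto

lemma noisy_density_mult_cond_mean: "noisy_density a * cond_mean a = yderiv (noisy_density a)"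
  using noisy_density_mult_right_inverse by (simp add: cond_mean_def mult.left_commute)

lemma cond_mean_nth_0 [simp]: "fps_nth (cond_mean a) 0 = 0"
  using fps_nth_quotient[OF _ noisy_density_mult_cond_mean, of 0] by (simp add: a0 pderiv_smult)

lemma cond_mean_nth_1: "fps_nth (cond_mean a) (Suc 0) = [:a 1:]"
  using fps_nth_quotient[OF _ noisy_density_mult_cond_mean, of "Suc 0"]
  by (simp add: a0 pderiv_smult pderiv_hermite_Suc)

lemma cond_mean_nth_2:
  assumes "a 1 = 0"
  shows "fps_nth (cond_mean a) 2 = smult (a 2) [:0, 1:]"
  using fps_nth_quotient[OF _ noisy_density_mult_cond_mean, of 2] assms
  by (simp add: a0 numeral_2_eq_2 cond_mean_nth_1 pderiv_smult pderiv_hermite_Suc hermite_1)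

text \<open>The noisy density solves the heat equation in self-similar variables; its logarithmic
  derivative therefore solves a Burgers equation.\<close>

lemma fps_XD_cond_mean:
  defines "V \<equiv> cond_mean a"
  shows "fps_XD V = V + yvar * yderiv V - yderiv (V * V) - yderiv (yderiv V)"
proof -
  define W where "W = noisy_density a"
  have W1: "yderiv W = W * V"
    using noisy_density_mult_cond_mean by (simp add: W_def V_def)
  have W2: "yderiv (yderiv W) = W * V * V + W * yderiv V"
    by (simp add: W1 yderiv_mult)
  have W3: "yderiv (yderiv (yderiv W)) = W * V * V * V + 3 * (W * V * yderiv V) + W * yderiv (yderiv V)"
    unfolding W2 yderiv_add yderiv_mult W1 by (simp add: algebra_simps)
  have heat: "fps_XD W = yvar * yderiv W - yderiv (yderiv W)"
    by (simp add: W_def fps_XD_noisy_density)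
  have "fps_XD W * V + W * fps_XD V = fps_XD (yderiv W)"
    unfolding W1 fps_XD_mult ..
  also have "\<dots> = yderiv (yvar * yderiv W - yderiv (yderiv W))"
    unfolding fps_XD_yderiv heat ..
  also have "\<dots> = yderiv W + yvar * yderiv (yderiv W) - yderiv (yderiv (yderiv W))"
    by (simp add: yderiv_diff yderiv_mult)
  finally have "W * fps_XD V = W * (V + yvar * yderiv V - yderiv (V * V) - yderiv (yderiv V))"
    unfolding heat W3 unfolding W2 unfolding W1 yderiv_mult by (simp add: algebra_simps)
  then show ?thesis
    using noisy_density_nonzero by (simp add: W_def)
qed

lemma gauss_ex_hermite_mult_cond_mean:
  defines "V \<equiv> cond_mean a"
  shows "(real n - 1 - real j) * gauss_ex (hermite j * fps_nth V n)
       = - real (Suc j) * gauss_ex (hermite (Suc j) * fps_nth (V * V) n)"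
proof -
  let ?p = "fps_nth V n"
  have "smult (real n) ?p = fps_nth (fps_XD V) n"
    by (simp add: of_nat_poly)
  also have "\<dots> = ?p + ([:0, 1:] * pderiv ?p - pderiv (pderiv ?p)) - pderiv (fps_nth (V * V) n)"
    unfolding V_def fps_XD_cond_mean by simp
  finally have "gauss_ex (hermite j * smult (real n) ?p) =
      gauss_ex (hermite j * (?p + ([:0, 1:] * pderiv ?p - pderiv (pderiv ?p)) - pderiv (fps_nth (V * V) n)))"
    by (rule arg_cong)
  also have "\<dots> = gauss_ex (hermite j * ?p) + real j * gauss_ex (hermite j * ?p)
      - real (Suc j) * gauss_ex (hermite (Suc j) * fps_nth (V * V) n)"
    by (simp only: distrib_left[of "hermite j"]
        right_diff_distrib'[of "hermite j" _ "pderiv (fps_nth (V * V) n)"]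
        gauss_ex_add gauss_ex_diff gauss_ex_hermite_mult_ode gauss_ex_hermite_Suc_mult)
  finally show ?thesis
    by (simp add: gauss_ex_smult algebra_simps)
qed

lemma cond_mean_eq_shift: "cond_mean a = fps_X * fps_shift 1 (cond_mean a)"
  by (rule fps_ext) simp

lemma noisy_density_mult_shift_cond_mean:
  "noisy_density a * fps_shift 1 (cond_mean a) = fps_shift 1 (yderiv (noisy_density a))"
proof -
  have "yderiv (noisy_density a) = noisy_density a * fps_shift 1 (cond_mean a) * fps_X"
    unfolding noisy_density_mult_cond_mean[symmetric] by (subst cond_mean_eq_shift) (simp only: mult_ac)
  then show ?thesis by (simp only: fps_shift_times_fps_X')
qed

lemma graded_shift_cond_mean: "graded (fps_shift 1 (cond_mean a))"
proof (rule graded_quotient[OF graded_noisy_density _ _ noisy_density_mult_shift_cond_mean])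
  show "graded (fps_shift 1 (yderiv (noisy_density a)))"
    unfolding graded_def shift_yderiv_noisy_density_nth
    by (meson degree_hermite_le degree_smult_le order_trans)
qed (simp add: a0)

lemma top_coeffs_shift_cond_mean: "top_coeffs (fps_shift 1 (cond_mean a)) = cumulant_fps a"
proof -
  have "mgf a = top_coeffs (noisy_density a)"
    by (rule fps_ext) (simp add: coeff_hermite_self)
  then have "mgf a * top_coeffs (fps_shift 1 (cond_mean a))
      = top_coeffs (fps_shift 1 (yderiv (noisy_density a)))"
    unfolding noisy_density_mult_shift_cond_mean[symmetric]
    by (simp only: top_coeffs_mult graded_noisy_density graded_shift_cond_mean)
  also have "\<dots> = fps_deriv (mgf a)"
    by (rule fps_ext) (simp add: pderiv_smult pderiv_hermite_Suc coeff_hermite_self)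
  also have "\<dots> = mgf a * cumulant_fps a"
    by (rule mgf_mult_cumulant_fps[symmetric])
  finally show ?thesis
    using a0 fps_nonzero_nth[of "mgf a"] by (auto intro: exI[of _ 0])
qed

lemma gauss_ex_hermite_mult_cond_mean_eq_0:
  assumes "n \<le> j"
  shows "gauss_ex (hermite j * fps_nth (cond_mean a) n) = 0"
proof (cases n)
  case (Suc m)
  have "degree (fps_nth (fps_shift 1 (cond_mean a)) m) \<le> m"
    using graded_shift_cond_mean by (simp only: graded_def)
  with assms Suc show ?thesis by (simp add: gauss_ex_hermite_eq_0)
qed simp

lemma gauss_ex_hermite_mult_cond_mean_Suc:
  "gauss_ex (hermite j * fps_nth (cond_mean a) (Suc j)) = fps_nth (cumulant_fps a) j"
proof -
  have "degree (fps_nth (fps_shift 1 (cond_mean a)) j) \<le> j"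
    using graded_shift_cond_mean by (simp only: graded_def)
  then show ?thesis
    unfolding top_coeffs_shift_cond_mean[symmetric] by (simp add: gauss_ex_hermite_eq_coeff)
qed

lemma gauss_ex_hermite_mult_cond_mean_square:
  "gauss_ex (hermite j * fps_nth (cond_mean a * cond_mean a) (Suc (Suc j)))
     = fps_nth (cumulant_fps a * cumulant_fps a) j"
proof -
  let ?U = "fps_shift 1 (cond_mean a)"
  have "cond_mean a * cond_mean a = fps_X * (fps_X * (?U * ?U))"
    by (subst (1 2) cond_mean_eq_shift) (simp only: mult_ac)
  then have "gauss_ex (hermite j * fps_nth (cond_mean a * cond_mean a) (Suc (Suc j)))
      = gauss_ex (hermite j * fps_nth (?U * ?U) j)"
    by simp
  also have "\<dots> = fps_nth (top_coeffs (?U * ?U)) j"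
    using graded_mult[OF graded_shift_cond_mean graded_shift_cond_mean]
    by (simp only: graded_def gauss_ex_hermite_eq_coeff top_coeffs_nth)
  finally show ?thesis
    by (simp only: top_coeffs_mult graded_shift_cond_mean top_coeffs_shift_cond_mean)
qed

text \<open>The optimality of \<open>V\<close>: replacing it by a truncation changes the mean square error only by the
  expectation of the squared tail.\<close>

lemma mmse_fps_nth_cutoff:
  fixes M :: nat
  defines "W \<equiv> noisy_density a" and "F \<equiv> fps_cutoff M (cond_mean a)"
  assumes "n < 2 * M"
  shows "fps_nth (gauss_fps (yderiv (yderiv W) - yderiv W * F - yderiv W * F + W * (F * F))) n
       = fps_nth (mmse_fps a) n"
proof -
  let ?V = "cond_mean a"
  let ?R = "?V - F"
  have "fps_nth (?R * ?R) m = 0" if "m < 2 * M" for m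
    unfolding fps_mult_nth F_def using that by (intro sum.neutral) auto
  then have "fps_nth (W * (?R * ?R)) n = 0"
    unfolding fps_mult_nth[of W] using assms(3) by (intro sum.neutral) auto
  moreover have "yderiv (yderiv W) - yderiv W * F - yderiv W * F + W * (F * F)
      = yderiv (yderiv W) - W * (?V * ?V) + W * (?R * ?R)"
    unfolding W_def noisy_density_mult_cond_mean[symmetric] by (simp add: algebra_simps)
  ultimately show ?thesis
    by (simp only: mmse_fps_def W_def gauss_fps_nth fps_add_nth add_0_right)
qed

end

subsection \<open>Comparing two moment sequences\<close>

text \<open>The perturbation of the conditional variance that is linear in \<open>d\<close>. The Burgers equation turns
  \<open>E (He\<^sub>i V\<^sup>2)\<close> into a multiple of \<open>E (He\<^sub>i\<^sub>-\<^sub>1 V)\<close>, which leaves a single sum.\<close>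

lemma gauss_fps_linear_perturbation:
  assumes "a 0 = 1" "d 0 = 0"
  defines "V \<equiv> cond_mean a" and "\<eta> \<equiv> noisy_density d"
  shows "fps_nth (gauss_fps (yderiv \<eta> * V + yderiv \<eta> * V - \<eta> * (V * V))) n
       = (\<Sum>i = 1..n. real n / real i * d i * gauss_ex (hermite (i - 1) * fps_nth V (n - i)))"
proof -
  let ?g = "\<lambda>i. gauss_ex (fps_nth (yderiv \<eta>) i * fps_nth V (n - i) + fps_nth (yderiv \<eta>) i * fps_nth V (n - i)
      - fps_nth \<eta> i * fps_nth (V * V) (n - i))"
  have g_eq: "?g i = real n / real i * d i * gauss_ex (hermite (i - 1) * fps_nth V (n - i))"
      if i: "i \<in> {1..n}" for i
  proof -
    obtain j where j: "i = Suc j" using i by (cases i) auto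
    let ?v = "gauss_ex (hermite j * fps_nth V (n - i))"
      and ?s = "gauss_ex (hermite i * fps_nth (V * V) (n - i))"
    have "(real n - 2 * real i) * ?v = - real i * ?s"
      using gauss_ex_hermite_mult_cond_mean[of a "n - i" j, OF assms(1)] i
      by (simp add: V_def j of_nat_diff algebra_simps)
    then have s: "?s = - (real n - 2 * real i) / real i * ?v"
      using i by (simp add: field_simps)
    have "?g i = d i * (2 * ?v - ?s)"
      unfolding \<eta>_def yderiv_nth noisy_density_nth j pderiv_smult pderiv_hermite_Suc mult_smult_left
        gauss_ex_add gauss_ex_diff gauss_ex_smult by (simp add: algebra_simps)
    then show ?thesis
      unfolding s using i by (simp add: j field_simps)
  qed
  have "fps_nth (gauss_fps (yderiv \<eta> * V + yderiv \<eta> * V - \<eta> * (V * V))) n = (\<Sum>i = 0..n. ?g i)"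
    by (simp only: gauss_fps_nth fps_sub_nth fps_add_nth fps_mult_nth[of \<eta>] fps_mult_nth[of "yderiv \<eta>"]
        sum.distrib[symmetric] sum_subtractf[symmetric] gauss_ex_sum)
  also have "\<dots> = (\<Sum>i = 1..n. ?g i)"
    by (simp add: sum.atLeast_Suc_atMost \<eta>_def assms(2))
  also have "\<dots> = (\<Sum>i = 1..n. real n / real i * d i * gauss_ex (hermite (i - 1) * fps_nth V (n - i)))"
    by (rule sum.cong[OF refl g_eq])
  finally show ?thesis .
qed

context
  fixes a b :: "nat \<Rightarrow> real" and k :: nat
  assumes a0: "a 0 = 1" and a1: "a 1 = 0" and b0: "b 0 = 1" and b1: "b 1 = 0"
    and k: "2 \<le> k" and agree: "\<And>i. i \<le> k \<Longrightarrow> b i = a i"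
begin

private definition "density_gap = fps_shift (Suc k) (noisy_density (\<lambda>n. b n - a n))"
private definition "residual = yderiv density_gap - density_gap * cond_mean a"
private definition "mean_gap = residual * fps_right_inverse (noisy_density b) 1"

private lemma noisy_density_diff_eq: "noisy_density b = noisy_density a + fps_X ^ Suc k * density_gap"
proof -
  have "noisy_density (\<lambda>n. b n - a n) = fps_X ^ Suc k * density_gap"
    by (rule fps_ext) (auto simp: density_gap_def fps_X_power_mult_nth agree simp del: power_Suc)
  then show ?thesis
    using noisy_density_diff[of b a] by (simp add: algebra_simps)
qed

private lemma noisy_density_mult_mean_gap: "noisy_density b * mean_gap = residual"
  using noisy_density_mult_right_inverse[of b, OF b0] by (simp add: mean_gap_def mult.left_commute)

private lemma yderiv_X_power_mult: "yderiv (fps_X ^ n * A) = fps_X ^ n * yderiv A"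
  by (rule fps_ext) (simp add: fps_X_power_mult_nth)

private lemma cond_mean_diff_eq: "cond_mean b = cond_mean a + fps_X ^ Suc k * mean_gap"
proof -
  have "noisy_density b * (cond_mean b - cond_mean a)
      = yderiv (noisy_density b) - noisy_density b * cond_mean a"
    unfolding right_diff_distrib noisy_density_mult_cond_mean[of b, OF b0] ..
  also have "\<dots> = fps_X ^ Suc k * residual"
    unfolding noisy_density_diff_eq yderiv_add yderiv_X_power_mult residual_def
      noisy_density_mult_cond_mean[of a, OF a0, symmetric] by (simp add: algebra_simps del: power_Suc)
  also have "\<dots> = noisy_density b * (fps_X ^ Suc k * mean_gap)"
    unfolding noisy_density_mult_mean_gap[symmetric] by (simp only: mult_ac)
  finally have "cond_mean b - cond_mean a = fps_X ^ Suc k * mean_gap"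
    using noisy_density_nonzero[of b, OF b0] by (simp del: power_Suc)
  then show ?thesis by (simp add: algebra_simps)
qed

private lemma linear_perturbation_eq:
  "(\<Sum>i = 1..n. real n / real i * (b i - a i) * gauss_ex (hermite (i - 1) * fps_nth (cond_mean a) (n - i)))
     = (\<Sum>i = Suc k..n div 2. real n / real i * (b i - a i)
          * gauss_ex (hermite (i - 1) * fps_nth (cond_mean a) (n - i)))"
proof (rule sum.mono_neutral_right)
  show "\<forall>i\<in>{1..n} - {Suc k..n div 2}.
      real n / real i * (b i - a i) * gauss_ex (hermite (i - 1) * fps_nth (cond_mean a) (n - i)) = 0"
  proof
    fix i assume "i \<in> {1..n} - {Suc k..n div 2}"
    then consider "i \<le> k" | "n - i \<le> i - 1" by fastforce
    then show "real n / real i * (b i - a i) * gauss_ex (hermite (i - 1) * fps_nth (cond_mean a) (n - i)) = 0"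
      using agree[of i] gauss_ex_hermite_mult_cond_mean_eq_0[of a "n - i" "i - 1", OF a0] by cases simp_all
  qed
qed auto

private lemma mmse_fps_diff:
  assumes "2 < n"
  shows "fps_nth (mmse_fps a) n - fps_nth (mmse_fps b) n
       = (\<Sum>i = Suc k..n div 2. real n / real i * (b i - a i)
            * gauss_ex (hermite (i - 1) * fps_nth (cond_mean a) (n - i)))
         + fps_nth (gauss_fps (fps_X ^ (2 * Suc k) * (residual * mean_gap))) n"
proof -
  let ?V = "cond_mean a" and ?X = "fps_X ^ Suc k :: real poly fps"
  define \<eta> where "\<eta> = noisy_density (\<lambda>n. b n - a n)"
  have \<eta>: "?X * density_gap = \<eta>" "noisy_density b = noisy_density a + \<eta>"
    using noisy_density_diff[of b a] noisy_density_diff_eq unfolding \<eta>_def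
    by (simp_all add: algebra_simps del: power_Suc)
  have residual: "?X * residual = yderiv \<eta> - \<eta> * ?V"
    unfolding residual_def \<eta>(1)[symmetric] yderiv_X_power_mult by (simp only: right_diff_distrib mult.assoc)
  have "noisy_density b * (cond_mean b * cond_mean b)
      = noisy_density b * (?V * ?V) + (?V + ?V) * (?X * (noisy_density b * mean_gap))
        + ?X * (noisy_density b * mean_gap) * (?X * mean_gap)"
    unfolding cond_mean_diff_eq by (simp only: algebra_simps)
  also have "\<dots> = (noisy_density a + \<eta>) * (?V * ?V) + (?V + ?V) * (yderiv \<eta> - \<eta> * ?V)
        + (?X * ?X) * (residual * mean_gap)"
    unfolding noisy_density_mult_mean_gap residual[symmetric] unfolding \<eta>(2) by (simp only: mult_ac)
  also have "?X * ?X = fps_X ^ (2 * Suc k)"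
    by (simp only: mult_2 power_add)
  also have "(noisy_density a + \<eta>) * (?V * ?V) + (?V + ?V) * (yderiv \<eta> - \<eta> * ?V)
      = noisy_density a * (?V * ?V) + (yderiv \<eta> * ?V + yderiv \<eta> * ?V - \<eta> * (?V * ?V))"
    by (simp only: algebra_simps)
  finally have square: "fps_nth (gauss_fps (noisy_density b * (cond_mean b * cond_mean b))) n
      = fps_nth (gauss_fps (noisy_density a * (?V * ?V))) n
        + fps_nth (gauss_fps (yderiv \<eta> * ?V + yderiv \<eta> * ?V - \<eta> * (?V * ?V))) n
        + fps_nth (gauss_fps (fps_X ^ (2 * Suc k) * (residual * mean_gap))) n"
    by (simp only: gauss_fps_add fps_add_nth)
  show ?thesis
    using assms gauss_fps_linear_perturbation[of a "\<lambda>n. b n - a n" n] a0 b0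
    unfolding mmse_fps_def gauss_fps_diff fps_sub_nth square gauss_fps_yderiv2_noisy_density
      linear_perturbation_eq[symmetric] \<eta>_def[symmetric]
    by simp
qed

private lemma density_gap_nth:
  "fps_nth density_gap n = smult (b (Suc (n + k)) - a (Suc (n + k))) (hermite (Suc (n + k)))"
  by (simp add: density_gap_def)

private lemma residual_nth_0: "fps_nth residual 0 = smult (b (Suc k) - a (Suc k)) (hermite k)"
  by (simp add: residual_def density_gap_nth pderiv_smult pderiv_hermite_Suc cond_mean_nth_0[of a, OF a0])

private lemma residual_nth_1: "fps_nth residual (Suc 0) = smult (b (k + 2) - a (k + 2)) (hermite (Suc k))"
  using a1 by (simp add: residual_def density_gap_nth pderiv_smult pderiv_hermite_Suc fps_mult_nth
      cond_mean_nth_0[of a, OF a0] cond_mean_nth_1[of a, OF a0])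

private lemma residual_nth_2:
  "fps_nth residual 2 = smult (b (k + 3) - a (k + 3)) (hermite (k + 2))
     - smult (a 2 * (b (Suc k) - a (Suc k))) ([:0, 1:] * hermite (Suc k))"
  using a1 cond_mean_nth_2[of a, OF a0 a1]
  by (simp add: residual_def density_gap_nth pderiv_smult pderiv_hermite_Suc fps_mult_nth numeral_2_eq_2
      numeral_3_eq_3 mult.commute[of _ "a _"] cond_mean_nth_0[of a, OF a0] cond_mean_nth_1[of a, OF a0])

private lemma mean_gap_nth_0: "fps_nth mean_gap 0 = fps_nth residual 0"
  using fps_nth_quotient[OF _ noisy_density_mult_mean_gap, of 0] b0 by simp

private lemma mean_gap_nth_1: "fps_nth mean_gap (Suc 0) = fps_nth residual (Suc 0)"
  using fps_nth_quotient[OF _ noisy_density_mult_mean_gap, of "Suc 0"] b0 b1 by simp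

private lemma mean_gap_nth_2:
  "fps_nth mean_gap 2 = fps_nth residual 2 - smult (a 2) (hermite 2 * fps_nth residual 0)"
  using fps_nth_quotient[OF _ noisy_density_mult_mean_gap, of 2] b0 b1 agree[of 2] k mean_gap_nth_0
  by (simp add: numeral_2_eq_2)

private lemma gauss_ex_excess_nth_2:
  "gauss_ex (fps_nth (residual * mean_gap) 2) = (b (k + 2) - a (k + 2))\<^sup>2 / fact (Suc k)
     - real (k + 2) * a 2 * (b (Suc k) - a (Suc k))\<^sup>2 / fact k"
proof -
  let ?r = "fps_nth residual" and ?d = "b (Suc k) - a (Suc k)"
  have "fps_nth (residual * mean_gap) 2
      = ?r 0 * fps_nth mean_gap 2 + ?r (Suc 0) * ?r (Suc 0) + ?r 2 * ?r 0"
    by (simp add: fps_mult_nth numeral_2_eq_2 mean_gap_nth_0 mean_gap_nth_1)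
  also have "\<dots> = ?r (Suc 0) * ?r (Suc 0) + (?r 0 * ?r 2 + ?r 0 * ?r 2)
      - smult (a 2) (hermite 2 * (?r 0 * ?r 0))"
    unfolding mean_gap_nth_2 by (simp add: algebra_simps)
  finally have "gauss_ex (fps_nth (residual * mean_gap) 2) = gauss_ex (?r (Suc 0) * ?r (Suc 0))
      + 2 * gauss_ex (?r 0 * ?r 2) - a 2 * gauss_ex (hermite 2 * (?r 0 * ?r 0))"
    by (simp only: gauss_ex_add gauss_ex_diff gauss_ex_smult)
  also have "gauss_ex (?r (Suc 0) * ?r (Suc 0)) = (b (k + 2) - a (k + 2))\<^sup>2 / fact (Suc k)"
    unfolding residual_nth_1 mult_smult_left mult_smult_right gauss_ex_smult gauss_ex_hermite_orthogonal
    by (simp add: power2_eq_square)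
  also have "gauss_ex (?r 0 * ?r 2) = - a 2 * ?d\<^sup>2 / fact k"
  proof -
    have "?r 0 * ?r 2 = smult (?d * (b (k + 3) - a (k + 3))) (hermite k * hermite (k + 2))
        - smult (a 2 * ?d\<^sup>2) ([:0, 1:] * (hermite k * hermite (Suc k)))"
      unfolding residual_nth_0 residual_nth_2 power2_eq_square
      by (simp only: right_diff_distrib mult_smult_left mult_smult_right smult_smult mult_ac)
    then show ?thesis
      by (simp only: gauss_ex_diff gauss_ex_smult gauss_ex_hermite_orthogonal gauss_ex_mult_hermite_Suc) simp
  qed
  also have "gauss_ex (hermite 2 * (?r 0 * ?r 0)) = ?d\<^sup>2 * real k / fact k"
    unfolding residual_nth_0 mult_smult_left mult_smult_right gauss_ex_smult gauss_ex_hermite_2_mult_square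
    by (simp add: power2_eq_square)
  finally show ?thesis by (simp add: algebra_simps add_divide_distrib)
qed

lemma mmse_fps_diff_nth_double:
  "fps_nth (mmse_fps a) (2 * Suc k) - fps_nth (mmse_fps b) (2 * Suc k)
     = (b (Suc k) - a (Suc k)) * (2 * fps_nth (cumulant_fps a) k + (b (Suc k) - a (Suc k)) / fact k)"
proof -
  let ?t = "\<lambda>i. real (2 * Suc k) / real i * (b i - a i)
      * gauss_ex (hermite (i - 1) * fps_nth (cond_mean a) (2 * Suc k - i))"
  have "(\<Sum>i = Suc k..2 * Suc k div 2. ?t i) = ?t (Suc k)" by simp
  also have "\<dots> = 2 * (b (Suc k) - a (Suc k)) * fps_nth (cumulant_fps a) k"
    using gauss_ex_hermite_mult_cond_mean_Suc[of a k, OF a0] by (simp add: field_simps)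
  finally have linear: "(\<Sum>i = Suc k..2 * Suc k div 2. ?t i)
      = 2 * (b (Suc k) - a (Suc k)) * fps_nth (cumulant_fps a) k" .
  have "fps_nth (gauss_fps (fps_X ^ (2 * Suc k) * (residual * mean_gap))) (2 * Suc k)
      = gauss_ex (fps_nth residual 0 * fps_nth residual 0)"
    by (simp add: fps_X_power_mult_nth mean_gap_nth_0 del: mult_Suc_right)
  also have "\<dots> = (b (Suc k) - a (Suc k))\<^sup>2 / fact k"
    unfolding residual_nth_0 mult_smult_left mult_smult_right gauss_ex_smult gauss_ex_hermite_orthogonal
    by (simp add: power2_eq_square)
  finally show ?thesis
    using mmse_fps_diff[of "2 * Suc k"] k linear by (simp add: power2_eq_square algebra_simps)
qed

lemma mmse_fps_diff_nth_double_add_2: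
  "fps_nth (mmse_fps a) (2 * Suc k + 2) - fps_nth (mmse_fps b) (2 * Suc k + 2)
     = (b (k + 2) - a (k + 2)) * (2 * fps_nth (cumulant_fps a) (Suc k) + (b (k + 2) - a (k + 2)) / fact (Suc k))
       - real (k + 2) * (b (Suc k) - a (Suc k))
         * (fps_nth (cumulant_fps a * cumulant_fps a) (Suc k) + a 2 * (b (Suc k) - a (Suc k)) / fact k)"
proof -
  let ?C = "cumulant_fps a"
  let ?n = "2 * Suc k + 2"
  let ?t = "\<lambda>i. real ?n / real i * (b i - a i) * gauss_ex (hermite (i - 1) * fps_nth (cond_mean a) (?n - i))"
  have "(\<Sum>i = Suc k..?n div 2. ?t i) = ?t (Suc k) + ?t (k + 2)" by simp
  also have "?t (k + 2) = 2 * (b (k + 2) - a (k + 2)) * fps_nth ?C (Suc k)"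
    using gauss_ex_hermite_mult_cond_mean_Suc[of a "Suc k", OF a0] by (simp add: field_simps)
  also have "?t (Suc k) = - real (k + 2) * (b (Suc k) - a (Suc k)) * fps_nth (?C * ?C) (Suc k)"
  proof -
    have "gauss_ex (hermite k * fps_nth (cond_mean a) (k + 3)) = - real (Suc k) / 2 * fps_nth (?C * ?C) (Suc k)"
      using gauss_ex_hermite_mult_cond_mean[of a "k + 3" k, OF a0]
        gauss_ex_hermite_mult_cond_mean_square[of a "Suc k", OF a0] by (simp add: numeral_3_eq_3)
    moreover have "?n - Suc k = k + 3" by simp
    ultimately show ?thesis by (simp only: diff_Suc_1) (simp add: field_simps)
  qed
  finally have linear: "(\<Sum>i = Suc k..?n div 2. ?t i)
      = - real (k + 2) * (b (Suc k) - a (Suc k)) * fps_nth (?C * ?C) (Suc k)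
      + 2 * (b (k + 2) - a (k + 2)) * fps_nth ?C (Suc k)" .
  have "fps_nth (gauss_fps (fps_X ^ (2 * Suc k) * (residual * mean_gap))) ?n
      = gauss_ex (fps_nth (residual * mean_gap) 2)"
    unfolding gauss_fps_nth fps_X_power_mult_nth by simp
  then show ?thesis
    using mmse_fps_diff[of ?n] linear unfolding gauss_ex_excess_nth_2
    by (simp add: power2_eq_square algebra_simps add_divide_distrib diff_divide_distrib)
qed

end

subsection \<open>Cumulants from moments\<close>

lemma nth_vderiv_eqI:
  assumes "open U" and deriv: "\<And>n t. t \<in> U \<Longrightarrow> (G n has_vector_derivative G (Suc n) t) (at t)"
    and "\<And>t. t \<in> U \<Longrightarrow> f t = G 0 t" and "t \<in> U"
  shows "nth_vderiv n f t = G n t"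
  using \<open>t \<in> U\<close>
proof (induction n arbitrary: t)
  case (Suc n)
  have "(nth_vderiv n f has_vector_derivative G (Suc n) t) (at t)"
    by (rule has_vector_derivative_transform_within_open[OF deriv[OF Suc.prems] \<open>open U\<close> Suc.prems])
       (simp add: Suc.IH)
  then show ?case by (simp add: nth_vderiv_def vector_derivative_at)
qed (simp add: nth_vderiv_def assms(3))

text \<open>The Taylor series of one function at varying points \<open>t\<close> form such a family. Dividing families replaces
  the Leibniz rule for the higher derivatives of a quotient.\<close>

definition taylor_family :: "real set \<Rightarrow> (real \<Rightarrow> 'a::real_normed_field fps) \<Rightarrow> bool" where
  "taylor_family U F \<longleftrightarrow>
     (\<forall>t\<in>U. \<forall>n. ((\<lambda>t. fps_nth (F t) n) has_vector_derivative fps_nth (fps_deriv (F t)) n) (at t))"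

lemma taylor_familyD:
  "taylor_family U F \<Longrightarrow> t \<in> U \<Longrightarrow>
     ((\<lambda>t. fps_nth (F t) n) has_vector_derivative fps_nth (fps_deriv (F t)) n) (at t)"
  by (simp add: taylor_family_def)

lemma taylor_family_fps_deriv:
  assumes "taylor_family U F"
  shows "taylor_family U (\<lambda>t. fps_deriv (F t))"
  unfolding taylor_family_def
proof (intro ballI allI)
  fix t n assume "t \<in> U"
  have "((\<lambda>t. of_nat (Suc n) * fps_nth (F t) (Suc n))
      has_vector_derivative of_nat (Suc n) * fps_nth (fps_deriv (F t)) (Suc n)) (at t)"
    by (intro has_vector_derivative_mult_right taylor_familyD[OF assms \<open>t \<in> U\<close>])
  then show "((\<lambda>t. fps_nth (fps_deriv (F t)) n)
      has_vector_derivative fps_nth (fps_deriv (fps_deriv (F t))) n) (at t)"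
    by simp
qed

lemma has_vector_derivative_quotient:
  fixes f g :: "real \<Rightarrow> 'a::real_normed_field"
  assumes "(f has_vector_derivative f') (at t)" "(g has_vector_derivative g') (at t)" "g t \<noteq> 0"
  shows "((\<lambda>t. f t / g t) has_vector_derivative (f' - f t / g t * g') / g t) (at t)"
proof -
  have "((\<lambda>t. inverse (g t)) has_vector_derivative g' * - (inverse (g t) ^ Suc (Suc 0))) (at t)"
    using field_vector_diff_chain_at[OF assms(2) DERIV_inverse[OF assms(3)]] by (simp add: o_def)
  from has_vector_derivative_mult[OF assms(1) this] show ?thesis
    by (simp add: divide_inverse algebra_simps)
qed

lemma taylor_family_mult_tail:
  assumes A: "taylor_family U A" and "t \<in> U"
    and Q: "\<And>m. m < n \<Longrightarrow> ((\<lambda>t. fps_nth (Q t) m) has_vector_derivative fps_nth (fps_deriv (Q t)) m) (at t)"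
  shows "((\<lambda>t. \<Sum>i = 1..n. fps_nth (A t) i * fps_nth (Q t) (n - i)) has_vector_derivative
      (\<Sum>i = 1..n. fps_nth (fps_deriv (A t)) i * fps_nth (Q t) (n - i)
         + fps_nth (A t) i * fps_nth (fps_deriv (Q t)) (n - i))) (at t)"
proof (rule has_vector_derivative_sum)
  fix i assume "i \<in> {1..n}"
  then have "((\<lambda>t. fps_nth (Q t) (n - i)) has_vector_derivative fps_nth (fps_deriv (Q t)) (n - i)) (at t)"
    by (intro Q) auto
  from has_vector_derivative_mult[OF taylor_familyD[OF A \<open>t \<in> U\<close>] this]
  show "((\<lambda>t. fps_nth (A t) i * fps_nth (Q t) (n - i)) has_vector_derivative
      fps_nth (fps_deriv (A t)) i * fps_nth (Q t) (n - i)
          + fps_nth (A t) i * fps_nth (fps_deriv (Q t)) (n - i)) (at t)"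
    by (simp add: add.commute)
qed

lemma taylor_family_divide:
  fixes A B :: "real \<Rightarrow> 'a::real_normed_field fps"
  assumes A: "taylor_family U A" and B: "taylor_family U B"
    and "open U" and nz: "\<And>t. t \<in> U \<Longrightarrow> fps_nth (A t) 0 \<noteq> 0"
  shows "taylor_family U (\<lambda>t. B t / A t)"
proof -
  define Q where "Q t = B t / A t" for t
  have AQ: "A t * Q t = B t" if "t \<in> U" for t
    using nz[OF that] by (simp add: Q_def fps_divide_unit mult.left_commute inverse_mult_eq_1')
  have Q_nth: "fps_nth (Q t) n
      = (fps_nth (B t) n - (\<Sum>i = 1..n. fps_nth (A t) i * fps_nth (Q t) (n - i))) / fps_nth (A t) 0"
    if "t \<in> U" for t n
    using fps_mult_nth_solve[of "A t" "Q t" n] nz[OF that] AQ[OF that] by (simp add: field_simps)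
  have "((\<lambda>t. fps_nth (Q t) n) has_vector_derivative fps_nth (fps_deriv (Q t)) n) (at t)" if "t \<in> U" for t n
  proof (induction n rule: less_induct)
    case (less n)
    let ?A = "fps_nth (A t)" and ?A' = "fps_nth (fps_deriv (A t))"
      and ?Q = "fps_nth (Q t)" and ?Q' = "fps_nth (fps_deriv (Q t))"
    define N where "N t = fps_nth (B t) n - (\<Sum>i = 1..n. fps_nth (A t) i * fps_nth (Q t) (n - i))" for t
    define N' where "N' = fps_nth (fps_deriv (B t)) n - (\<Sum>i = 1..n. ?A' i * ?Q (n - i) + ?A i * ?Q' (n - i))"
    have "(N has_vector_derivative N') (at t)"
      unfolding N_def[abs_def] N'_def
      by (intro has_vector_derivative_diff taylor_familyD[OF B \<open>t \<in> U\<close>]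
          taylor_family_mult_tail[OF A \<open>t \<in> U\<close>] less.IH)
    then have "((\<lambda>t. N t / fps_nth (A t) 0) has_vector_derivative (N' - N t / ?A 0 * ?A' 0) / ?A 0) (at t)"
      by (intro has_vector_derivative_quotient taylor_familyD[OF A \<open>t \<in> U\<close>] nz \<open>t \<in> U\<close>)
    also have "(N' - N t / ?A 0 * ?A' 0) / ?A 0 = ?Q' n"
    proof -
      have "fps_deriv (B t) = fps_deriv (A t) * Q t + A t * fps_deriv (Q t)"
        unfolding AQ[OF \<open>t \<in> U\<close>, symmetric] by (simp add: add.commute)
      then have "N' = ?A' 0 * ?Q n + ?A 0 * ?Q' n"
        by (simp add: N'_def fps_mult_nth sum.atLeast_Suc_atMost sum.distrib del: fps_deriv_nth)
      then show ?thesis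
        unfolding N_def Q_nth[OF \<open>t \<in> U\<close>, symmetric] using nz[OF \<open>t \<in> U\<close>] by simp
    qed
    finally show ?case
      by (rule has_vector_derivative_transform_within_open[OF _ \<open>open U\<close> \<open>t \<in> U\<close>])
         (unfold N_def, rule Q_nth[symmetric])
  qed
  then show ?thesis by (simp add: taylor_family_def Q_def)
qed

lemma has_vector_derivative_integral_of_quadratic_error:
  fixes f :: "real \<Rightarrow> 'a \<Rightarrow> 'b::{banach, second_countable_topology}" and g :: "'a \<Rightarrow> real"
  assumes f: "\<And>s. integrable M (f s)" and f': "integrable M f'" and g: "integrable M g"
    and error: "\<And>h x. norm (f (t + h) x - f t x - h *\<^sub>R f' x) \<le> h\<^sup>2 * g x"
  shows "((\<lambda>s. \<integral>x. f s x \<partial>M) has_vector_derivative (\<integral>x. f' x \<partial>M)) (at t)"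
proof -
  let ?F = "\<lambda>s. \<integral>x. f s x \<partial>M" and ?D = "\<integral>x. f' x \<partial>M" and ?C = "\<integral>x. g x \<partial>M"
  have bound: "norm (?F (t + h) - ?F t - h *\<^sub>R ?D) \<le> \<bar>h\<bar> * (\<bar>h\<bar> * ?C)" for h
  proof -
    have "?F (t + h) - ?F t - h *\<^sub>R ?D = (\<integral>x. f (t + h) x - f t x - h *\<^sub>R f' x \<partial>M)"
      using f f' by simp
    also have "norm \<dots> \<le> (\<integral>x. h\<^sup>2 * g x \<partial>M)"
      by (rule order_trans[OF integral_norm_bound integral_mono]) (use f f' g error in auto)
    finally show ?thesis by (simp add: power2_eq_square flip: mult.assoc)
  qed
  have "((\<lambda>h. norm (?F (t + h) - ?F t - h *\<^sub>R ?D) / norm h) \<longlongrightarrow> 0) (at 0)"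
  proof (rule Lim_null_comparison)
    show "\<forall>\<^sub>F h in at 0. norm (norm (?F (t + h) - ?F t - h *\<^sub>R ?D) / norm h) \<le> \<bar>h\<bar> * ?C"
      using bound by (auto simp: eventually_at_filter divide_simps mult_ac)
    show "((\<lambda>h. \<bar>h\<bar> * ?C) \<longlongrightarrow> 0) (at 0)"
      by (auto intro!: tendsto_eq_intros)
  qed
  then show ?thesis
    unfolding has_vector_derivative_def has_derivative_at by (simp add: bounded_linear_scaleR_left)
qed

definition moment :: "real measure \<Rightarrow> nat \<Rightarrow> real" where
  "moment \<nu> n = (\<integral>x. x ^ n \<partial>\<nu>)"

locale moment_law = prob_space \<nu> for \<nu> :: "real measure" +
  assumes sets_law [measurable_cong, simp]: "sets \<nu> = sets borel"
    and integrable_power [simp]: "\<And>n::nat. integrable \<nu> (\<lambda>x. x ^ n)"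
begin

lemma space_law [simp]: "space \<nu> = UNIV"
  using sets_eq_imp_space_eq[OF sets_law] by simp

lemma integrable_abs_power [simp]: "integrable \<nu> (\<lambda>x. \<bar>x\<bar> ^ n)"
  using integrable_abs[OF integrable_power[of n]] by (simp add: power_abs)

lemma moment_0 [simp]: "moment \<nu> 0 = 1"
  using prob_space by (simp add: moment_def)

lemma moment_2_nonneg: "moment \<nu> 2 \<ge> 0"
  by (simp add: moment_def)

definition char_deriv :: "nat \<Rightarrow> real \<Rightarrow> complex" where
  "char_deriv n t = (CLINT x|\<nu>. (\<i> * complex_of_real x) ^ n * iexp (t * x))"

lemma integrable_char_deriv: "complex_integrable \<nu> (\<lambda>x. (\<i> * complex_of_real x) ^ n * iexp (t * x))"
  by (rule Bochner_Integration.integrable_bound[OF integrable_abs_power[of n]])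
     (auto simp: norm_mult norm_power)

lemma char_deriv_has_vector_derivative:
  "(char_deriv n has_vector_derivative char_deriv (Suc n) t) (at t)"
  unfolding char_deriv_def[abs_def]
proof (rule has_vector_derivative_integral_of_quadratic_error)
  show "integrable \<nu> (\<lambda>x. \<bar>x\<bar> ^ (n + 2) / 2)"
    by (intro integrable_divide integrable_abs_power)
  fix h x :: real
  let ?d = "(\<i> * complex_of_real x) ^ n * iexp ((t + h) * x) - (\<i> * complex_of_real x) ^ n * iexp (t * x)
      - h *\<^sub>R ((\<i> * complex_of_real x) ^ Suc n * iexp (t * x))"
  have "?d = (\<i> * complex_of_real x) ^ n * iexp (t * x)
      * (iexp (h * x) - (\<Sum>k\<le>1. (\<i> * complex_of_real (h * x)) ^ k / fact k))"
    by (simp add: algebra_simps exp_add scaleR_conv_of_real)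
  also have "norm \<dots> \<le> \<bar>x\<bar> ^ n * (\<bar>h * x\<bar> ^ 2 / 2)"
    unfolding norm_mult using iexp_approx1[of "h * x" 1]
    by (intro mult_mono) (auto simp: norm_power norm_mult numeral_2_eq_2)
  also have "\<dots> = h\<^sup>2 * (\<bar>x\<bar> ^ (n + 2) / 2)"
    by (simp add: power_mult_distrib power_add) (simp add: power2_eq_square)
  finally show "norm ?d \<le> h\<^sup>2 * (\<bar>x\<bar> ^ (n + 2) / 2)" .
qed (rule integrable_char_deriv)+

lemma char_deriv_at_0: "char_deriv n 0 = \<i> ^ n * complex_of_real (moment \<nu> n)"
proof -
  have "char_deriv n 0 = (CLINT x|\<nu>. \<i> ^ n * complex_of_real (x ^ n))"
    by (simp add: char_deriv_def power_mult_distrib)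
  also have "\<dots> = \<i> ^ n * complex_of_real (moment \<nu> n)"
    unfolding moment_def integral_mult_right_zero integral_complex_of_real ..
  finally show ?thesis .
qed

definition char_taylor :: "real \<Rightarrow> complex fps" where
  "char_taylor t = Abs_fps (\<lambda>n. char_deriv n t / fact n)"

lemma char_taylor_nth [simp]: "fps_nth (char_taylor t) n = char_deriv n t / fact n"
  by (simp add: char_taylor_def)

lemma taylor_family_char_taylor: "taylor_family U char_taylor"
  unfolding taylor_family_def
proof (intro ballI allI)
  fix t n
  have "((\<lambda>t. char_deriv n t / fact n) has_vector_derivative char_deriv (Suc n) t / fact n) (at t)"
    by (intro has_vector_derivative_divide char_deriv_has_vector_derivative)
  then show "((\<lambda>t. fps_nth (char_taylor t) n)
      has_vector_derivative fps_nth (fps_deriv (char_taylor t)) n) (at t)"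
    by (simp del: of_nat_Suc)
qed

lemma log_char_taylor_at_0:
  "fps_nth (fps_deriv (char_taylor 0) / char_taylor 0) n
     = \<i> ^ Suc n * complex_of_real (fps_nth (cumulant_fps (moment \<nu>)) n)"
proof -
  define rot :: "real fps \<Rightarrow> complex fps"
    where "rot A = Abs_fps (\<lambda>n. \<i> ^ n * complex_of_real (fps_nth A n))" for A
  let ?E = "mgf (moment \<nu>)" and ?C = "cumulant_fps (moment \<nu>)"
  have rot_mult: "rot (A * B) = rot A * rot B" for A B
  proof (rule fps_ext)
    fix n
    have "\<i> ^ n = \<i> ^ i * \<i> ^ (n - i)" if "i \<in> {0..n}" for i
      using that by (simp flip: power_add)
    then show "fps_nth (rot (A * B)) n = fps_nth (rot A * rot B) n"
      by (simp add: rot_def fps_mult_nth sum_distrib_left mult_ac)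
  qed
  have char_taylor: "char_taylor 0 = rot ?E"
    by (rule fps_ext) (simp add: rot_def char_deriv_at_0)
  then have "fps_deriv (char_taylor 0) = fps_const \<i> * rot (fps_deriv ?E)"
    by (intro fps_ext) (simp add: rot_def del: of_nat_Suc)
  also have "rot (fps_deriv ?E) = char_taylor 0 * rot ?C"
    unfolding char_taylor rot_mult[symmetric] mgf_mult_cumulant_fps[of "moment \<nu>", OF moment_0] ..
  finally have "fps_deriv (char_taylor 0) = fps_const \<i> * rot ?C * char_taylor 0"
    by (simp only: mult_ac)
  moreover have "char_taylor 0 \<noteq> 0"
    using fps_nonzero_nth[of "char_taylor 0"] by (auto simp: char_deriv_at_0 intro!: exI[of _ 0])
  ultimately have "fps_deriv (char_taylor 0) / char_taylor 0 = fps_const \<i> * rot ?C"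
    by simp
  then show ?thesis by (simp add: rot_def)
qed

lemma cumulant_Suc: "cumulant \<nu> (Suc n) = fact n * fps_nth (cumulant_fps (moment \<nu>)) n"
proof -
  define U where "U = {t. Re (char_deriv 0 t) > 0}"
  define Q where "Q t = fps_deriv (char_taylor t) / char_taylor t" for t
  define G where "G n t = (case n of 0 \<Rightarrow> Ln (char_deriv 0 t) | Suc m \<Rightarrow> fact m * fps_nth (Q t) m)" for n t
  have "continuous_on UNIV (char_deriv 0)"
    by (auto intro!: continuous_at_imp_continuous_on has_vector_derivative_continuous
        char_deriv_has_vector_derivative)
  then have "open U"
    unfolding U_def by (auto intro!: open_Collect_less continuous_intros)
  have U: "char_deriv 0 t \<notin> \<real>\<^sub>\<le>\<^sub>0" "fps_nth (char_taylor t) 0 \<noteq> 0" if "t \<in> U" for t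
    using that by (auto simp: U_def complex_nonpos_Reals_iff)
  have Q: "taylor_family U Q"
    unfolding Q_def[abs_def]
    by (intro taylor_family_divide taylor_family_fps_deriv taylor_family_char_taylor \<open>open U\<close> U(2))
  have deriv: "(G n has_vector_derivative G (Suc n) t) (at t)" if "t \<in> U" for n t
  proof (cases n)
    case 0
    have "(Ln \<circ> char_deriv 0 has_vector_derivative char_deriv (Suc 0) t * inverse (char_deriv 0 t)) (at t)"
      by (rule field_vector_diff_chain_at[OF char_deriv_has_vector_derivative
            has_field_derivative_Ln[OF U(1)[OF that]]])
    then show ?thesis
      using U(2)[OF that] by (simp add: 0 G_def[abs_def] Q_def o_def divide_inverse)
  next
    case (Suc m)
    have "((\<lambda>t. fact m * fps_nth (Q t) m) has_vector_derivative fact m * fps_nth (fps_deriv (Q t)) m) (at t)"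
      by (intro has_vector_derivative_mult_right taylor_familyD[OF Q that])
    then show ?thesis by (simp add: Suc G_def[abs_def] mult_ac)
  qed
  have "0 \<in> U" by (simp add: U_def char_deriv_at_0)
  then have "nth_vderiv (Suc n) (\<lambda>t. Ln (char \<nu> t)) 0 = G (Suc n) 0"
    by (intro nth_vderiv_eqI[where G = G, OF \<open>open U\<close> deriv]) (simp_all add: G_def char_def char_deriv_def)
  also have "\<dots> = \<i> ^ Suc n * complex_of_real (fact n * fps_nth (cumulant_fps (moment \<nu>)) n)"
    by (simp add: G_def Q_def log_char_taylor_at_0)
  finally have "(- \<i>) ^ Suc n * nth_vderiv (Suc n) (\<lambda>t. Ln (char \<nu> t)) 0
      = ((- \<i>) ^ Suc n * \<i> ^ Suc n) * complex_of_real (fact n * fps_nth (cumulant_fps (moment \<nu>)) n)"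
    by (simp only: mult.assoc)
  also have "(- \<i>) ^ Suc n * \<i> ^ Suc n = 1"
    by (subst power_mult_distrib[symmetric]) simp
  finally show ?thesis
    unfolding cumulant_def by (simp only: mult_1_left Re_complex_of_real)
qed

end

subsection \<open>Gaussian tilts\<close>

definition tilt :: "real \<Rightarrow> real \<Rightarrow> real" where
  "tilt t y = exp (t * y - t\<^sup>2 / 2)"

lemma tilt_nonneg [simp]: "tilt t y \<ge> 0"
  by (simp add: tilt_def)

lemma tilt_measurable [measurable (raw)]:
  assumes [measurable]: "f \<in> borel_measurable M" "g \<in> borel_measurable M"
  shows "(\<lambda>x. tilt (f x) (g x)) \<in> borel_measurable M"
  unfolding tilt_def by measurable

lemma tilt_le: "tilt t y \<le> exp (y\<^sup>2 / 2)"
proof -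
  have "(y - t)\<^sup>2 \<ge> 0" by simp
  then show ?thesis by (simp add: tilt_def power2_eq_square algebra_simps)
qed

lemma tilt_le_exp_abs:
  assumes "\<bar>t\<bar> \<le> 1"
  shows "tilt t y \<le> exp \<bar>y\<bar>"
proof -
  have "\<bar>t * y\<bar> \<le> 1 * \<bar>y\<bar>" unfolding abs_mult using assms by (intro mult_right_mono) auto
  then have "t * y - t\<^sup>2 / 2 \<le> \<bar>y\<bar>" using zero_le_power2[of t] by linarith
  then show ?thesis by (simp add: tilt_def)
qed

lemma DERIV_hermite_tilt:
  "DERIV (\<lambda>t. fact m * poly (hermite m) (y - t) * tilt t y) t :>
     fact (Suc m) * poly (hermite (Suc m)) (y - t) * tilt t y"
proof -
  have "DERIV (\<lambda>t. poly (hermite m) (y - t)) t :> poly (pderiv (hermite m)) (y - t) * (0 - 1)"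
    by (rule DERIV_chain2[OF poly_DERIV]) (auto intro!: derivative_eq_intros)
  moreover have "DERIV (\<lambda>t. tilt t y) t :> (y - t) * tilt t y"
    unfolding tilt_def by (auto intro!: derivative_eq_intros simp: power2_eq_square)
  ultimately have "DERIV (\<lambda>t. poly (hermite m) (y - t) * tilt t y) t :>
      poly (pderiv (hermite m)) (y - t) * (0 - 1) * tilt t y + (y - t) * tilt t y * poly (hermite m) (y - t)"
    by (rule DERIV_mult)
  also have "poly (pderiv (hermite m)) (y - t) * (0 - 1) * tilt t y
      + (y - t) * tilt t y * poly (hermite m) (y - t)
      = poly ([:0, 1:] * hermite m - pderiv (hermite m)) (y - t) * tilt t y"
    by (simp add: algebra_simps)
  also have "\<dots> = real (Suc m) * poly (hermite (Suc m)) (y - t) * tilt t y"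
    unfolding smult_hermite_Suc[symmetric] by simp
  finally have "DERIV (\<lambda>t. fact m * (poly (hermite m) (y - t) * tilt t y)) t :>
      fact m * (real (Suc m) * poly (hermite (Suc m)) (y - t) * tilt t y)"
    by (rule DERIV_cmult)
  then show ?thesis by (simp add: mult_ac del: of_nat_Suc)
qed

lemma abs_poly_shift_le_poly:
  fixes p :: "real poly"
  obtains h where "\<And>u y. \<bar>u\<bar> \<le> 1 \<Longrightarrow> \<bar>poly p (y - u)\<bar> \<le> poly h y"
proof -
  have "\<exists>h. \<forall>u y. \<bar>u\<bar> \<le> 1 \<longrightarrow> \<bar>poly p (y - u)\<bar> \<le> poly h y"
  proof (induction p)
    case (pCons a p)
    then obtain h where h: "\<And>u y. \<bar>u\<bar> \<le> 1 \<Longrightarrow> \<bar>poly p (y - u)\<bar> \<le> poly h y" by blast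
    have "\<bar>poly (pCons a p) (y - u)\<bar> \<le> poly ([:\<bar>a\<bar>:] + [:2, 0, 1:] * h) y" if "\<bar>u\<bar> \<le> 1" for u y
    proof -
      have "\<bar>y\<bar> \<le> 1 + y\<^sup>2"
        using zero_le_power2[of "\<bar>y\<bar> - 1"] by (simp add: power2_diff)
      then have "\<bar>y - u\<bar> \<le> 2 + y\<^sup>2" using that by linarith
      then have "\<bar>y - u\<bar> * \<bar>poly p (y - u)\<bar> \<le> (2 + y\<^sup>2) * poly h y"
        using h[OF that] by (intro mult_mono) auto
      then show ?thesis
        using abs_triangle_ineq[of a "(y - u) * poly p (y - u)"]
        by (simp add: abs_mult power2_eq_square distrib_right mult.assoc)
    qed
    then show ?case by blast
  qed (auto intro: exI[of _ 0])
  with that show thesis by blast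
qed

lemma tilt_Taylor_near:
  obtains h where "\<And>t y. \<bar>t\<bar> \<le> 1 \<Longrightarrow>
    \<bar>tilt t y - (\<Sum>j<M. t ^ j * poly (hermite j) y)\<bar> \<le> \<bar>t\<bar> ^ M * (poly h y * exp \<bar>y\<bar>)"
proof -
  obtain h where h: "\<And>u y. \<bar>u\<bar> \<le> 1 \<Longrightarrow> \<bar>poly (hermite M) (y - u)\<bar> \<le> poly h y"
    using abs_poly_shift_le_poly[of "hermite M"] by blast
  have "\<bar>tilt t y - (\<Sum>j<M. t ^ j * poly (hermite j) y)\<bar> \<le> \<bar>t\<bar> ^ M * (poly h y * exp \<bar>y\<bar>)"
    if "\<bar>t\<bar> \<le> 1" for t y
  proof -
    obtain u where u: "\<bar>u\<bar> \<le> \<bar>t\<bar>"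
      and eq: "tilt t y = (\<Sum>m<M. (fact m * poly (hermite m) (y - 0) * tilt 0 y) / fact m * t ^ m)
        + (fact M * poly (hermite M) (y - u) * tilt u y) / fact M * t ^ M"
      using Maclaurin_bi_le[of "\<lambda>m t. fact m * poly (hermite m) (y - t) * tilt t y" "\<lambda>t. tilt t y" M t]
        DERIV_hermite_tilt by auto
    have "tilt t y - (\<Sum>j<M. t ^ j * poly (hermite j) y) = t ^ M * (poly (hermite M) (y - u) * tilt u y)"
      unfolding eq by (simp add: tilt_def mult.commute)
    then have "\<bar>tilt t y - (\<Sum>j<M. t ^ j * poly (hermite j) y)\<bar>
        = \<bar>t\<bar> ^ M * (\<bar>poly (hermite M) (y - u)\<bar> * tilt u y)"
      by (simp add: abs_mult power_abs)
    also have "\<dots> \<le> \<bar>t\<bar> ^ M * (poly h y * exp \<bar>y\<bar>)"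
    proof (intro mult_left_mono mult_mono tilt_le_exp_abs h)
      show "0 \<le> poly h y" using h[of 0 y] by linarith
    qed (use u that in auto)
    finally show ?thesis .
  qed
  with that show thesis by blast
qed

lemma hermite_sum_bound_far:
  obtains h where "\<And>t y. \<bar>t\<bar> \<ge> 1 \<Longrightarrow> \<bar>\<Sum>j<M. t ^ j * poly (hermite j) y\<bar> \<le> \<bar>t\<bar> ^ M * poly h y"
proof -
  have "\<exists>h. \<forall>u y. \<bar>u\<bar> \<le> 1 \<longrightarrow> \<bar>poly (hermite j) (y - u)\<bar> \<le> poly h y" for j
    by (rule abs_poly_shift_le_poly[of "hermite j"]) blast
  then obtain b where b: "\<And>j u y. \<bar>u\<bar> \<le> 1 \<Longrightarrow> \<bar>poly (hermite j) (y - u)\<bar> \<le> poly (b j) y"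
    by metis
  have "\<bar>\<Sum>j<M. t ^ j * poly (hermite j) y\<bar> \<le> \<bar>t\<bar> ^ M * poly (\<Sum>j<M. b j) y" if "\<bar>t\<bar> \<ge> 1" for t y
  proof -
    have "\<bar>\<Sum>j<M. t ^ j * poly (hermite j) y\<bar> \<le> (\<Sum>j<M. \<bar>t ^ j * poly (hermite j) y\<bar>)"
      by (rule sum_abs)
    also have "\<dots> \<le> (\<Sum>j<M. \<bar>t\<bar> ^ M * poly (b j) y)"
    proof (rule sum_mono)
      fix j assume "j \<in> {..<M}"
      then have "\<bar>t\<bar> ^ j \<le> \<bar>t\<bar> ^ M" using that by (intro power_increasing) auto
      then show "\<bar>t ^ j * poly (hermite j) y\<bar> \<le> \<bar>t\<bar> ^ M * poly (b j) y"
        unfolding abs_mult power_abs using b[of 0 j y] by (intro mult_mono) auto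
    qed
    finally show ?thesis by (simp add: poly_sum sum_distrib_left)
  qed
  with that show thesis by blast
qed

text \<open>For \<open>\<bar>t\<bar> > 1\<close> the Taylor remainder is only controlled by the tilt itself, which is what makes the
  bound usable without exponential moments.\<close>

lemma tilt_Taylor:
  obtains h where "\<And>y. poly h y \<ge> 0"
    "\<And>t y. \<bar>tilt t y - (\<Sum>j<M. t ^ j * poly (hermite j) y)\<bar> \<le> \<bar>t\<bar> ^ M * (poly h y * exp \<bar>y\<bar> + tilt t y)"
proof -
  obtain h1 where near: "\<And>t y. \<bar>t\<bar> \<le> 1 \<Longrightarrow>
      \<bar>tilt t y - (\<Sum>j<M. t ^ j * poly (hermite j) y)\<bar> \<le> \<bar>t\<bar> ^ M * (poly h1 y * exp \<bar>y\<bar>)"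
    using tilt_Taylor_near[of M] by blast
  obtain h2 where far: "\<And>t y. \<bar>t\<bar> \<ge> 1 \<Longrightarrow> \<bar>\<Sum>j<M. t ^ j * poly (hermite j) y\<bar> \<le> \<bar>t\<bar> ^ M * poly h2 y"
    using hermite_sum_bound_far[of M] by blast
  have "0 \<le> poly h1 y * exp \<bar>y\<bar>" for y using near[of 1 y] by simp
  then have h1: "0 \<le> poly h1 y" for y by (simp add: zero_le_mult_iff)
  have h2: "0 \<le> poly h2 y" for y using far[of 1 y] by simp
  have "\<bar>tilt t y - (\<Sum>j<M. t ^ j * poly (hermite j) y)\<bar>
      \<le> \<bar>t\<bar> ^ M * (poly (h1 + h2) y * exp \<bar>y\<bar> + tilt t y)" for t y
  proof (cases "\<bar>t\<bar> \<le> 1")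
    case True
    have "poly h1 y * exp \<bar>y\<bar> \<le> poly (h1 + h2) y * exp \<bar>y\<bar> + tilt t y"
      using h2[of y] by (simp add: distrib_right)
    then show ?thesis
      using near[OF True, of y] by (meson abs_ge_zero mult_left_mono order_trans zero_le_power)
  next
    case False
    have "1 \<le> \<bar>t\<bar> ^ M" using False by (intro one_le_power) auto
    then have "tilt t y \<le> \<bar>t\<bar> ^ M * tilt t y" using mult_right_mono[of 1 "\<bar>t\<bar> ^ M" "tilt t y"] by simp
    moreover have "\<bar>t\<bar> ^ M * poly h2 y \<le> \<bar>t\<bar> ^ M * (poly (h1 + h2) y * exp \<bar>y\<bar>)"
    proof (intro mult_left_mono)
      have "poly h2 y * 1 \<le> poly (h1 + h2) y * exp \<bar>y\<bar>"
        using h1 h2 by (intro mult_mono) auto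
      then show "poly h2 y \<le> poly (h1 + h2) y * exp \<bar>y\<bar>" by simp
    qed simp
    ultimately show ?thesis
      using far[of t y] False tilt_nonneg[of t y] unfolding distrib_left by linarith
  qed
  with h1 h2 show thesis by (intro that[of "h1 + h2"]) simp_all
qed

lemma tilt_Taylor_scaled:
  obtains h where "\<And>e x y. 0 \<le> e \<Longrightarrow> e \<le> 1 \<Longrightarrow>
    \<bar>(e * x) ^ i * (tilt (e * x) y - (\<Sum>j<M. (e * x) ^ j * poly (hermite j) y))\<bar>
      \<le> e ^ M * (poly h y * exp \<bar>y\<bar>) * \<bar>x\<bar> ^ (i + M) + \<bar>e * x\<bar> ^ (i + M) * tilt (e * x) y"
proof -
  obtain h where h: "\<And>y. poly h y \<ge> 0"
    "\<And>t y. \<bar>tilt t y - (\<Sum>j<M. t ^ j * poly (hermite j) y)\<bar> \<le> \<bar>t\<bar> ^ M * (poly h y * exp \<bar>y\<bar> + tilt t y)"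
    using tilt_Taylor[of M] by blast
  have "\<bar>(e * x) ^ i * (tilt (e * x) y - (\<Sum>j<M. (e * x) ^ j * poly (hermite j) y))\<bar>
      \<le> e ^ M * (poly h y * exp \<bar>y\<bar>) * \<bar>x\<bar> ^ (i + M) + \<bar>e * x\<bar> ^ (i + M) * tilt (e * x) y"
    if e: "0 \<le> e" "e \<le> 1" for e x y
  proof -
    let ?c = "poly h y * exp \<bar>y\<bar>"
    have "\<bar>(e * x) ^ i * (tilt (e * x) y - (\<Sum>j<M. (e * x) ^ j * poly (hermite j) y))\<bar>
        \<le> \<bar>e * x\<bar> ^ i * (\<bar>e * x\<bar> ^ M * (?c + tilt (e * x) y))"
      unfolding abs_mult[of "(e * x) ^ i"] power_abs by (intro mult_left_mono h(2)) simp
    also have "\<dots> = e ^ (i + M) * (?c * \<bar>x\<bar> ^ (i + M)) + \<bar>e * x\<bar> ^ (i + M) * tilt (e * x) y"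
      using e by (simp add: abs_mult power_add power_mult_distrib algebra_simps)
    also have "e ^ (i + M) * (?c * \<bar>x\<bar> ^ (i + M)) \<le> e ^ M * (?c * \<bar>x\<bar> ^ (i + M))"
      using e h(1)[of y] by (intro mult_right_mono power_decreasing) auto
    finally show ?thesis by (simp add: mult.assoc)
  qed
  then show thesis by (rule that)
qed

lemma nn_integral_gaussian_shift:
  fixes g :: "real \<Rightarrow> ennreal"
  assumes [measurable]: "g \<in> borel_measurable borel"
  shows "(\<integral>\<^sup>+n. g (t + n) \<partial>gaussian) = (\<integral>\<^sup>+y. tilt t y * g y \<partial>gaussian)"
proof -
  have eq: "std_normal_density (y - t) = std_normal_density y * tilt t y" for y
    by (simp add: std_normal_density_def tilt_def exp_add[symmetric] power2_eq_square field_simps)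
  have "(\<integral>\<^sup>+n. g (t + n) \<partial>gaussian) = (\<integral>\<^sup>+n. std_normal_density n * g (t + n) \<partial>lborel)"
    by (subst nn_integral_density) auto
  also have "\<dots> = (\<integral>\<^sup>+y. std_normal_density (y - t) * g y \<partial>lborel)"
    by (subst nn_integral_real_affine[of "\<lambda>y. std_normal_density (y - t) * g y" 1 t]) auto
  also have "\<dots> = (\<integral>\<^sup>+y. tilt t y * g y \<partial>gaussian)"
    unfolding eq by (subst nn_integral_density) (auto simp: ennreal_mult mult.assoc)
  finally show ?thesis .
qed

lemma integrable_mult_of_squares:
  fixes f g :: "'a \<Rightarrow> real"
  assumes [measurable]: "f \<in> borel_measurable M" "g \<in> borel_measurable M"
    and "integrable M (\<lambda>x. (f x)\<^sup>2)" "integrable M (\<lambda>x. (g x)\<^sup>2)"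
  shows "integrable M (\<lambda>x. f x * g x)"
proof (rule Bochner_Integration.integrable_bound)
  show "integrable M (\<lambda>x. (f x)\<^sup>2 + (g x)\<^sup>2)" using assms by simp
  have "\<bar>u * v\<bar> \<le> u\<^sup>2 + v\<^sup>2" for u v :: real
    using sum_squares_bound[of "\<bar>u\<bar>" "\<bar>v\<bar>"] mult_nonneg_nonneg[of "\<bar>u\<bar>" "\<bar>v\<bar>"]
    by (simp only: abs_mult power2_abs) linarith
  then show "AE x in M. norm (f x * g x) \<le> norm ((f x)\<^sup>2 + (g x)\<^sup>2)"
    by (intro AE_I2) (auto simp: abs_of_nonneg)
qed simp

lemma integral_weighted_Cauchy_Schwarz:
  fixes f w :: "'a \<Rightarrow> real"
  assumes w: "integrable M w" "\<And>x. x \<in> space M \<Longrightarrow> 0 \<le> w x"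
    and fw: "integrable M (\<lambda>x. f x * w x)" and f2w: "integrable M (\<lambda>x. (f x)\<^sup>2 * w x)"
  shows "(\<integral>x. f x * w x \<partial>M)\<^sup>2 \<le> (\<integral>x. w x \<partial>M) * (\<integral>x. (f x)\<^sup>2 * w x \<partial>M)"
proof -
  let ?W = "\<integral>x. w x \<partial>M" and ?A = "\<integral>x. f x * w x \<partial>M" and ?B = "\<integral>x. (f x)\<^sup>2 * w x \<partial>M"
  have quadratic: "0 \<le> ?B - 2 * c * ?A + c\<^sup>2 * ?W" for c
  proof -
    have "0 \<le> (\<integral>x. (f x - c)\<^sup>2 * w x \<partial>M)"
      using w by (intro integral_nonneg_AE AE_I2) auto
    also have "(\<lambda>x. (f x - c)\<^sup>2 * w x) = (\<lambda>x. (f x)\<^sup>2 * w x - 2 * c * (f x * w x) + c\<^sup>2 * w x)"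
      by (auto simp: power2_eq_square algebra_simps)
    also have "integral\<^sup>L M \<dots> = ?B - 2 * c * ?A + c\<^sup>2 * ?W"
      using w fw f2w by simp
    finally show ?thesis .
  qed
  have "?W \<ge> 0" using w by (intro integral_nonneg_AE AE_I2) auto
  then consider "?W > 0" | "?W = 0" by linarith
  then show ?thesis
  proof cases
    case 1
    then show ?thesis using quadratic[of "?A / ?W"] by (simp add: power2_eq_square field_simps)
  next
    case 2
    have "?A = 0"
    proof (rule ccontr)
      assume "?A \<noteq> 0"
      then show False using quadratic[of "(?B + 1) / (2 * ?A)"] 2 by simp
    qed
    then show ?thesis using 2 by simp
  qed
qed

lemma integrable_gaussian_exp_abs: "integrable gaussian (\<lambda>y. exp (c * \<bar>y\<bar>))"
proof -
  have tilt: "integrable gaussian (tilt t)" for t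
  proof (rule integrableI_nonneg)
    interpret prob_space gaussian by (rule prob_space_normal_density) simp
    have "(\<integral>\<^sup>+y. ennreal (tilt t y) \<partial>gaussian) = (\<integral>\<^sup>+n. 1 \<partial>gaussian)"
      using nn_integral_gaussian_shift[of "\<lambda>_. 1" t] by simp
    also have "\<dots> = 1" using emeasure_space_1 by simp
    finally show "(\<integral>\<^sup>+y. ennreal (tilt t y) \<partial>gaussian) < \<infinity>" by simp
  qed auto
  have tilts: "integrable gaussian (\<lambda>y. exp (c\<^sup>2 / 2) * (tilt c y + tilt (- c) y))"
    by (intro integrable_mult_right Bochner_Integration.integrable_add tilt)
  have "exp (c * \<bar>y\<bar>) \<le> exp (c\<^sup>2 / 2) * (tilt c y + tilt (- c) y)" for y
    by (cases "y \<ge> 0") (simp_all add: tilt_def distrib_left exp_add[symmetric])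
  then have "AE y in gaussian. norm (exp (c * \<bar>y\<bar>)) \<le> norm (exp (c\<^sup>2 / 2) * (tilt c y + tilt (- c) y))"
    by (auto intro!: AE_I2 order_trans[OF _ abs_ge_self])
  then show ?thesis
    by (intro Bochner_Integration.integrable_bound[OF tilts]) simp_all
qed

lemma borel_measurable_poly [measurable]: "poly p \<in> borel_measurable borel" for p :: "real poly"
  by (intro borel_measurable_continuous_onI continuous_intros)

lemma integrable_gaussian_poly_mult_exp_abs: "integrable gaussian (\<lambda>y. poly p y * exp (c * \<bar>y\<bar>))"
proof (rule integrable_mult_of_squares)
  show "integrable gaussian (\<lambda>y. (poly p y)\<^sup>2)"
    using integrable_gaussian_poly[of "p * p"] by (simp add: poly_mult[abs_def] power2_eq_square)
  show "integrable gaussian (\<lambda>y. (exp (c * \<bar>y\<bar>))\<^sup>2)"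
    using integrable_gaussian_exp_abs[of "2 * c"] by (simp add: power2_eq_square mult.assoc flip: exp_add)
qed measurable

subsection \<open>The conditional mean and the minimum mean square error\<close>

context moment_law
begin

sublocale P: pair_prob_space \<nu> gaussian
proof -
  interpret N: prob_space gaussian by (rule prob_space_normal_density) simp
  show "pair_prob_space \<nu> gaussian" ..
qed

abbreviation joint :: "(real \<times> real) measure" where
  "joint \<equiv> \<nu> \<Otimes>\<^sub>M gaussian"

abbreviation obs :: "real \<Rightarrow> real \<times> real \<Rightarrow> real" where
  "obs e z \<equiv> e * fst z + snd z"

lemma sets_joint [measurable_cong, simp]: "sets joint = sets (borel \<Otimes>\<^sub>M borel)"
  by (intro sets_pair_measure_cong) auto

lemma space_joint [simp]: "space joint = UNIV"
  by (simp add: space_pair_measure)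

lemma nn_integral_obs:
  fixes F :: "real \<times> real \<Rightarrow> ennreal"
  assumes [measurable]: "F \<in> borel_measurable (borel \<Otimes>\<^sub>M borel)"
  shows "(\<integral>\<^sup>+z. F (fst z, obs e z) \<partial>joint) = (\<integral>\<^sup>+z. tilt (e * fst z) (snd z) * F z \<partial>joint)"
proof -
  have "(\<integral>\<^sup>+z. F (fst z, obs e z) \<partial>joint) = (\<integral>\<^sup>+x. (\<integral>\<^sup>+n. F (x, e * x + n) \<partial>gaussian) \<partial>\<nu>)"
    by (subst P.M2.nn_integral_fst[symmetric]) simp_all
  also have "\<dots> = (\<integral>\<^sup>+x. (\<integral>\<^sup>+y. tilt (e * x) y * F (x, y) \<partial>gaussian) \<partial>\<nu>)"
    by (subst nn_integral_gaussian_shift) simp_all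
  also have "\<dots> = (\<integral>\<^sup>+z. tilt (e * fst z) (snd z) * F z \<partial>joint)"
    by (subst P.M2.nn_integral_fst[symmetric]) simp_all
  finally show ?thesis .
qed

lemma distr_obs:
  "distr joint (borel \<Otimes>\<^sub>M borel) (\<lambda>z. (fst z, obs e z)) = density joint (\<lambda>z. tilt (e * fst z) (snd z))"
proof (rule measure_eqI)
  fix A assume "A \<in> sets (distr joint (borel \<Otimes>\<^sub>M borel) (\<lambda>z. (fst z, obs e z)))"
  then have A [measurable]: "A \<in> sets (borel \<Otimes>\<^sub>M borel)" by simp
  have "emeasure (distr joint (borel \<Otimes>\<^sub>M borel) (\<lambda>z. (fst z, obs e z))) A
      = (\<integral>\<^sup>+z. indicator A z \<partial>distr joint (borel \<Otimes>\<^sub>M borel) (\<lambda>z. (fst z, obs e z)))"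
    by (subst nn_integral_indicator) simp_all
  also have "\<dots> = (\<integral>\<^sup>+z. indicator A (fst z, obs e z) \<partial>joint)"
    by (subst nn_integral_distr) simp_all
  also have "\<dots> = (\<integral>\<^sup>+z. tilt (e * fst z) (snd z) * (indicator A z :: ennreal) \<partial>joint)"
    by (rule nn_integral_obs) simp
  also have "\<dots> = emeasure (density joint (\<lambda>z. tilt (e * fst z) (snd z))) A"
    by (subst emeasure_density) simp_all
  finally show "emeasure (distr joint (borel \<Otimes>\<^sub>M borel) (\<lambda>z. (fst z, obs e z))) A
      = emeasure (density joint (\<lambda>z. tilt (e * fst z) (snd z))) A" .
qed simp

lemma integrable_obs_iff:
  fixes F :: "real \<times> real \<Rightarrow> real"
  assumes [measurable]: "F \<in> borel_measurable (borel \<Otimes>\<^sub>M borel)"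
  shows "integrable joint (\<lambda>z. F (fst z, obs e z)) \<longleftrightarrow> integrable joint (\<lambda>z. tilt (e * fst z) (snd z) * F z)"
proof -
  have "integrable joint (\<lambda>z. F (fst z, obs e z))
      \<longleftrightarrow> integrable (distr joint (borel \<Otimes>\<^sub>M borel) (\<lambda>z. (fst z, obs e z))) F"
    by (subst integrable_distr_eq) simp_all
  also have "\<dots> \<longleftrightarrow> integrable joint (\<lambda>z. tilt (e * fst z) (snd z) * F z)"
    unfolding distr_obs by (subst integrable_density) simp_all
  finally show ?thesis .
qed

lemma integral_obs:
  fixes F :: "real \<times> real \<Rightarrow> real"
  assumes [measurable]: "F \<in> borel_measurable (borel \<Otimes>\<^sub>M borel)"
  shows "(\<integral>z. F (fst z, obs e z) \<partial>joint) = (\<integral>z. tilt (e * fst z) (snd z) * F z \<partial>joint)"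
proof -
  have "(\<integral>z. F (fst z, obs e z) \<partial>joint)
      = integral\<^sup>L (distr joint (borel \<Otimes>\<^sub>M borel) (\<lambda>z. (fst z, obs e z))) F"
    by (subst integral_distr) simp_all
  also have "\<dots> = (\<integral>z. tilt (e * fst z) (snd z) * F z \<partial>joint)"
    unfolding distr_obs by (subst integral_density) simp_all
  finally show ?thesis .
qed

text \<open>\<open>tilted_moment e 0\<close> is the density of \<open>e X + N\<close> relative to that of \<open>N\<close>, and \<open>post_mean e y\<close> is
  \<open>E (e X | e X + N = y)\<close>.\<close>

definition tilted_moment :: "real \<Rightarrow> nat \<Rightarrow> real \<Rightarrow> real" where
  "tilted_moment e n y = (\<integral>x. (e * x) ^ n * tilt (e * x) y \<partial>\<nu>)"

definition post_mean :: "real \<Rightarrow> real \<Rightarrow> real" where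
  "post_mean e y = tilted_moment e 1 y / tilted_moment e 0 y"

definition abs_tilted_moment :: "real \<Rightarrow> nat \<Rightarrow> real \<Rightarrow> real" where
  "abs_tilted_moment e n y = (\<integral>x. \<bar>e * x\<bar> ^ n * tilt (e * x) y \<partial>\<nu>)"

lemma tilted_moment_measurable [measurable]: "tilted_moment e n \<in> borel_measurable borel"
  unfolding tilted_moment_def[abs_def] by measurable

lemma post_mean_measurable [measurable]: "post_mean e \<in> borel_measurable borel"
  unfolding post_mean_def[abs_def] by measurable

lemma integrable_mult_tilt:
  assumes "integrable \<nu> g"
  shows "integrable \<nu> (\<lambda>x. g x * tilt (e * x) y)"
proof (rule Bochner_Integration.integrable_bound)
  show "integrable \<nu> (\<lambda>x. exp (y\<^sup>2 / 2) * g x)" using assms by simp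
  have [measurable]: "g \<in> borel_measurable borel" using borel_measurable_integrable[OF assms] by simp
  show "(\<lambda>x. g x * tilt (e * x) y) \<in> borel_measurable \<nu>" by measurable
  show "AE x in \<nu>. norm (g x * tilt (e * x) y) \<le> norm (exp (y\<^sup>2 / 2) * g x)"
  proof (rule AE_I2)
    fix x show "norm (g x * tilt (e * x) y) \<le> norm (exp (y\<^sup>2 / 2) * g x)"
      using mult_left_mono[OF tilt_le[of "e * x" y], of "\<bar>g x\<bar>"] by (simp add: abs_mult mult.commute)
  qed
qed

lemma integrable_tilt: "integrable \<nu> (\<lambda>x. tilt (e * x) y)"
  using integrable_mult_tilt[of "\<lambda>_. 1"] by simp

lemma integrable_power_mult_tilt: "integrable \<nu> (\<lambda>x. (e * x) ^ n * tilt (e * x) y)"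
  by (intro integrable_mult_tilt) (simp add: power_mult_distrib)

lemma integrable_abs_power_mult_tilt: "integrable \<nu> (\<lambda>x. \<bar>e * x\<bar> ^ n * tilt (e * x) y)"
  by (intro integrable_mult_tilt) (simp add: abs_mult power_mult_distrib)

lemma abs_tilted_moment_square_le:
  "(abs_tilted_moment e n y)\<^sup>2 \<le> tilted_moment e 0 y * tilted_moment e (2 * n) y"
proof -
  have square: "(\<bar>u\<bar> ^ n)\<^sup>2 = u ^ (2 * n)" for u :: real
    by (simp add: power_mult[symmetric] mult.commute[of n] power_even_abs)
  show ?thesis
    using integral_weighted_Cauchy_Schwarz[OF integrable_tilt _ integrable_abs_power_mult_tilt[of e n y]]
      integrable_power_mult_tilt[of e "2 * n" y]
    by (simp add: square tilted_moment_def abs_tilted_moment_def)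
qed

text \<open>Jensen's inequality for the exponential, in the form \<open>1 + u \<le> exp u\<close>.\<close>

lemma tilted_moment_0_ge: "exp (e * y * moment \<nu> 1 - e\<^sup>2 * moment \<nu> 2 / 2) \<le> tilted_moment e 0 y"
proof -
  define c where "c = e * y * moment \<nu> 1 - e\<^sup>2 * moment \<nu> 2 / 2"
  define g where "g = (\<lambda>x. exp c * (1 + (e * y * x ^ 1 - e\<^sup>2 / 2 * x ^ 2) - c))"
  have int: "integrable \<nu> g"
    unfolding g_def by (intro integrable_mult_right Bochner_Integration.integrable_add
        Bochner_Integration.integrable_diff integrable_power integrable_const)
  have "(\<integral>x. g x \<partial>\<nu>) = exp c * (1 + (e * y * moment \<nu> 1 - e\<^sup>2 / 2 * moment \<nu> 2) - c)"
    unfolding g_def moment_def using integrable_power[of 1] integrable_power[of 2] prob_space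
    by (simp del: integrable_power)
  also have "\<dots> = exp c" by (simp add: c_def)
  finally have "exp c = (\<integral>x. g x \<partial>\<nu>)" ..
  also have "\<dots> \<le> (\<integral>x. tilt (e * x) y \<partial>\<nu>)"
  proof (rule integral_mono[OF int integrable_tilt])
    fix x
    let ?u = "e * y * x - e\<^sup>2 / 2 * x\<^sup>2"
    have "exp c * (1 + (?u - c)) \<le> exp c * exp (?u - c)"
      by (intro mult_left_mono exp_ge_add_one_self) simp
    then show "g x \<le> tilt (e * x) y"
      by (simp add: g_def tilt_def exp_add[symmetric] power_mult_distrib mult_ac add_diff_eq)
  qed
  finally show ?thesis by (simp add: c_def tilted_moment_def)
qed

lemma tilted_moment_0_pos: "tilted_moment e 0 y > 0"
  by (rule less_le_trans[OF exp_gt_zero tilted_moment_0_ge])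

lemma tilted_moment_0_mult_post_mean: "tilted_moment e 0 y * post_mean e y = tilted_moment e 1 y"
  using tilted_moment_0_pos[of e y] by (simp add: post_mean_def)

lemma
  fixes g :: "real \<Rightarrow> real"
  assumes [measurable]: "g \<in> borel_measurable borel"
    and int: "integrable joint (\<lambda>z. (e * fst z) ^ n * g (obs e z))"
  shows integrable_mult_tilted_moment: "integrable gaussian (\<lambda>y. g y * tilted_moment e n y)"
    and integral_mult_tilted_moment:
      "(\<integral>y. g y * tilted_moment e n y \<partial>gaussian) = (\<integral>z. (e * fst z) ^ n * g (obs e z) \<partial>joint)"
proof -
  let ?f = "\<lambda>x y. tilt (e * x) y * ((e * x) ^ n * g y)"
  have f: "integrable joint (\<lambda>(x, y). ?f x y)"
    using int integrable_obs_iff[of "\<lambda>z. (e * fst z) ^ n * g (snd z)" e] by (simp add: case_prod_beta')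
  have inner: "(\<integral>x. ?f x y \<partial>\<nu>) = g y * tilted_moment e n y" for y
    unfolding tilted_moment_def by (subst integral_mult_right_zero[symmetric]) (simp add: mult_ac)
  show "integrable gaussian (\<lambda>y. g y * tilted_moment e n y)"
    using P.integrable_snd[OF f] unfolding inner .
  have "(\<integral>y. g y * tilted_moment e n y \<partial>gaussian) = (\<integral>z. ?f (fst z) (snd z) \<partial>joint)"
    using P.integral_snd[OF f] unfolding inner by (simp add: case_prod_beta')
  also have "\<dots> = (\<integral>z. (e * fst z) ^ n * g (obs e z) \<partial>joint)"
    using integral_obs[of "\<lambda>z. (e * fst z) ^ n * g (snd z)" e] by simp
  finally show "(\<integral>y. g y * tilted_moment e n y \<partial>gaussian) = (\<integral>z. (e * fst z) ^ n * g (obs e z) \<partial>joint)" .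
qed

lemma integrable_obs_if_integrable_mult_tilted_moment:
  fixes g :: "real \<Rightarrow> real"
  assumes [measurable]: "g \<in> borel_measurable borel" and nonneg: "\<And>y. g y \<ge> 0"
    and int: "integrable gaussian (\<lambda>y. g y * tilted_moment e 0 y)"
  shows "integrable joint (\<lambda>z. g (obs e z))"
proof (rule integrableI_nonneg)
  have "(\<integral>\<^sup>+z. ennreal (g (obs e z)) \<partial>joint) = (\<integral>\<^sup>+z. tilt (e * fst z) (snd z) * ennreal (g (snd z)) \<partial>joint)"
    using nn_integral_obs[of "\<lambda>z. ennreal (g (snd z))" e] by simp
  also have "\<dots> = (\<integral>\<^sup>+y. (\<integral>\<^sup>+x. ennreal (tilt (e * x) y) * ennreal (g y) \<partial>\<nu>) \<partial>gaussian)"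
    by (subst P.nn_integral_snd[symmetric]) simp_all
  also have "\<dots> = (\<integral>\<^sup>+y. ennreal (g y * tilted_moment e 0 y) \<partial>gaussian)"
  proof (intro nn_integral_cong)
    fix y
    have "(\<integral>\<^sup>+x. ennreal (tilt (e * x) y) \<partial>\<nu>) = ennreal (tilted_moment e 0 y)"
      by (subst nn_integral_eq_integral) (simp_all add: integrable_tilt tilted_moment_def)
    moreover have "(\<integral>\<^sup>+x. ennreal (tilt (e * x) y) * ennreal (g y) \<partial>\<nu>)
        = (\<integral>\<^sup>+x. ennreal (tilt (e * x) y) \<partial>\<nu>) * ennreal (g y)"
      by (rule nn_integral_multc) measurable
    ultimately show "(\<integral>\<^sup>+x. ennreal (tilt (e * x) y) * ennreal (g y) \<partial>\<nu>) = ennreal (g y * tilted_moment e 0 y)"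
      using nonneg[of y] tilted_moment_0_pos[of e y]
      by (simp add: ennreal_mult mult.commute)
  qed
  also have "\<dots> = ennreal (\<integral>y. g y * tilted_moment e 0 y \<partial>gaussian)"
    using nonneg tilted_moment_0_pos by (intro nn_integral_eq_integral int) (simp add: less_imp_le)
  finally show "(\<integral>\<^sup>+z. ennreal (g (obs e z)) \<partial>joint) < \<infinity>" by simp
qed (use nonneg in simp_all)

lemma integrable_joint_product:
  fixes f g :: "real \<Rightarrow> real"
  assumes "integrable \<nu> f" "integrable gaussian g"
  shows "integrable joint (\<lambda>z. f (fst z) * g (snd z))"
proof (rule P.Fubini_integrable)
  have [measurable]: "f \<in> borel_measurable borel" "g \<in> borel_measurable borel"
    using assms[THEN borel_measurable_integrable] by simp_all
  show "(\<lambda>z. f (fst z) * g (snd z)) \<in> borel_measurable joint" by measurable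
  show "integrable \<nu> (\<lambda>x. \<integral>y. norm (f (fst (x, y)) * g (snd (x, y))) \<partial>gaussian)"
    using assms(1) by (simp add: abs_mult)
  show "AE x in \<nu>. integrable gaussian (\<lambda>y. f (fst (x, y)) * g (snd (x, y)))"
    using assms(2) by simp
qed

lemma integrable_fst_power: "integrable joint (\<lambda>z. fst z ^ n)"
  using integrable_joint_product[of "\<lambda>x. x ^ n" "\<lambda>_. 1"] by simp

lemma square_integrable_signal: "integrable joint (\<lambda>z. (e * fst z)\<^sup>2)"
  using integrable_fst_power[of 2] by (simp add: power_mult_distrib)

lemma square_integrable_post_mean: "integrable joint (\<lambda>z. (post_mean e (obs e z))\<^sup>2)"
proof (rule integrable_obs_if_integrable_mult_tilted_moment)
  have "integrable gaussian (tilted_moment e 2)"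
    using integrable_mult_tilted_moment[of "\<lambda>_. 1" e 2] square_integrable_signal by simp
  then show "integrable gaussian (\<lambda>y. (post_mean e y)\<^sup>2 * tilted_moment e 0 y)"
  proof (rule Bochner_Integration.integrable_bound)
    show "AE y in gaussian. norm ((post_mean e y)\<^sup>2 * tilted_moment e 0 y) \<le> norm (tilted_moment e 2 y)"
    proof (rule AE_I2)
      fix y
      let ?Z = "tilted_moment e 0 y"
      have "?Z > 0" by (rule tilted_moment_0_pos)
      have "(tilted_moment e 1 y)\<^sup>2 \<le> ?Z * tilted_moment e 2 y"
        using integral_weighted_Cauchy_Schwarz[OF integrable_tilt _ integrable_power_mult_tilt[of e 1 y]]
          integrable_power_mult_tilt[of e 2 y] by (simp add: tilted_moment_def)
      then have "(post_mean e y)\<^sup>2 * ?Z \<le> tilted_moment e 2 y"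
        using \<open>?Z > 0\<close> by (simp add: post_mean_def power_divide power2_eq_square field_simps)
      then show "norm ((post_mean e y)\<^sup>2 * ?Z) \<le> norm (tilted_moment e 2 y)"
        using \<open>?Z > 0\<close> by simp
    qed
  qed measurable
qed simp_all

lemma integral_signal_mult_obs:
  assumes [measurable]: "b \<in> borel_measurable borel" and b: "integrable joint (\<lambda>z. (b (obs e z))\<^sup>2)"
  shows "integrable joint (\<lambda>z. e * fst z * b (obs e z))"
    and "integrable joint (\<lambda>z. post_mean e (obs e z) * b (obs e z))"
    and "(\<integral>z. e * fst z * b (obs e z) \<partial>joint) = (\<integral>z. post_mean e (obs e z) * b (obs e z) \<partial>joint)"
proof -
  show signal: "integrable joint (\<lambda>z. e * fst z * b (obs e z))"
    by (intro integrable_mult_of_squares b square_integrable_signal) measurable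
  show mean: "integrable joint (\<lambda>z. post_mean e (obs e z) * b (obs e z))"
    by (intro integrable_mult_of_squares b square_integrable_post_mean) measurable
  have "(\<integral>z. e * fst z * b (obs e z) \<partial>joint) = (\<integral>y. b y * tilted_moment e 1 y \<partial>gaussian)"
    using integral_mult_tilted_moment[of b e 1] signal by simp
  also have "\<dots> = (\<integral>y. post_mean e y * b y * tilted_moment e 0 y \<partial>gaussian)"
    unfolding tilted_moment_0_mult_post_mean[symmetric] by (simp only: mult_ac)
  also have "\<dots> = (\<integral>z. post_mean e (obs e z) * b (obs e z) \<partial>joint)"
    using integral_mult_tilted_moment[of "\<lambda>y. post_mean e y * b y" e 0] mean by simp
  finally show "(\<integral>z. e * fst z * b (obs e z) \<partial>joint) = (\<integral>z. post_mean e (obs e z) * b (obs e z) \<partial>joint)" .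
qed

lemma cond_exp_eq_post_mean:
  assumes "e > 0"
  shows "AE z in joint. real_cond_exp joint (vimage_algebra (space joint) (obs e) borel) fst z
           = post_mean e (obs e z) / e"
proof -
  define F where "F = vimage_algebra (space joint) (obs e) borel"
  have setsF: "sets F = {obs e -` A \<inter> UNIV | A. A \<in> sets borel}"
    unfolding F_def by (subst sets_vimage_algebra2) auto
  have obs [measurable]: "obs e \<in> measurable F borel"
    unfolding F_def by (rule measurable_vimage_algebra1) simp
  have "subalgebra joint F"
  proof -
    have "obs e -` A \<in> sets joint" if "A \<in> sets borel" for A
      using measurable_sets[of "obs e" joint borel A] that by simp
    then show ?thesis
      unfolding subalgebra_def setsF by (auto simp: F_def)
  qed
  then interpret finite_measure_subalgebra joint F
    by unfold_locales
  have "AE z in joint. real_cond_exp joint F fst z = post_mean e (obs e z) / e"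
  proof (rule real_cond_exp_charact)
    show "integrable joint fst" using integrable_fst_power[of 1] by simp
    show "integrable joint (\<lambda>z. post_mean e (obs e z) / e)"
      by (rule integrable_divide[OF P.P.square_integrable_imp_integrable[OF _ square_integrable_post_mean]])
        measurable
    fix A assume "A \<in> sets F"
    then obtain B where B: "A = obs e -` B" and [measurable]: "B \<in> sets borel"
      unfolding setsF by auto
    have ind: "indicator A z = (indicator B (obs e z) :: real)" for z
      by (simp add: B indicator_def)
    have "integrable joint (\<lambda>z. (indicator B (obs e z) :: real)\<^sup>2)"
      by (rule P.P.integrable_const_bound[of _ 1]) (auto simp: indicator_def)
    then have "e * (\<integral>z. indicator A z * fst z \<partial>joint) = (\<integral>z. indicator A z * post_mean e (obs e z) \<partial>joint)"
      using integral_signal_mult_obs(3)[of "indicator B" e]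
      by (simp add: ind mult_ac flip: integral_mult_right_zero)
    then show "(\<integral>z\<in>A. fst z \<partial>joint) = (\<integral>z\<in>A. post_mean e (obs e z) / e \<partial>joint)"
      using \<open>e > 0\<close> by (simp add: set_lebesgue_integral_def field_simps)
  qed measurable
  then show ?thesis by (simp add: F_def)
qed

lemma mmse_eq_post_mean_error:
  assumes "e > 0"
  shows "e\<^sup>2 * mmse \<nu> (e\<^sup>2) = (\<integral>z. (e * fst z - post_mean e (obs e z))\<^sup>2 \<partial>joint)"
proof -
  let ?F = "vimage_algebra (space joint) (obs e) borel"
  have "mmse \<nu> (e\<^sup>2) = (\<integral>z. (fst z - real_cond_exp joint ?F fst z)\<^sup>2 \<partial>joint)"
    using assms by (simp add: mmse_def Let_def del: space_joint)
  also have "\<dots> = (\<integral>z. (fst z - post_mean e (obs e z) / e)\<^sup>2 \<partial>joint)"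
  proof (rule integral_cong_AE)
    show "(\<lambda>z. (fst z - real_cond_exp joint ?F fst z)\<^sup>2) \<in> borel_measurable joint"
      using borel_measurable_cond_exp2[of joint ?F fst] by measurable
    show "AE z in joint. (fst z - real_cond_exp joint ?F fst z)\<^sup>2 = (fst z - post_mean e (obs e z) / e)\<^sup>2"
      using cond_exp_eq_post_mean[OF assms] by eventually_elim (simp del: space_joint)
  qed measurable
  finally have "e\<^sup>2 * mmse \<nu> (e\<^sup>2) = (\<integral>z. e\<^sup>2 * (fst z - post_mean e (obs e z) / e)\<^sup>2 \<partial>joint)"
    by simp
  then show ?thesis
    using assms by (simp add: right_diff_distrib flip: power_mult_distrib)
qed

lemma mean_square_error_eq:
  assumes "e > 0" and [measurable]: "f \<in> borel_measurable borel"
    and f: "integrable joint (\<lambda>z. (f (obs e z))\<^sup>2)"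
  shows "integrable joint (\<lambda>z. (f (obs e z) - post_mean e (obs e z))\<^sup>2)"
    and "(\<integral>z. (e * fst z - f (obs e z))\<^sup>2 \<partial>joint)
       = e\<^sup>2 * mmse \<nu> (e\<^sup>2) + (\<integral>z. (f (obs e z) - post_mean e (obs e z))\<^sup>2 \<partial>joint)"
proof -
  let ?g = "\<lambda>z. post_mean e (obs e z)" and ?b = "\<lambda>y. f y - post_mean e y"
  have "integrable joint (\<lambda>z. f (obs e z) * ?g z)"
    by (intro integrable_mult_of_squares f square_integrable_post_mean) measurable
  then show b: "integrable joint (\<lambda>z. (f (obs e z) - ?g z)\<^sup>2)"
    unfolding power2_diff using f square_integrable_post_mean[of e] by (simp add: mult.assoc)
  have "integrable joint (\<lambda>z. e * fst z * ?g z)"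
    by (rule integral_signal_mult_obs(1)[OF _ square_integrable_post_mean]) measurable
  then have error: "integrable joint (\<lambda>z. (e * fst z - ?g z)\<^sup>2)"
    unfolding power2_diff using square_integrable_signal[of e] square_integrable_post_mean[of e]
    by (simp add: mult.assoc)
  note cross = integral_signal_mult_obs[of ?b e, OF _ b]
  have "(e * fst z - f (obs e z))\<^sup>2 = (e * fst z - ?g z)\<^sup>2 - 2 * (e * fst z * ?b (obs e z) - ?g z * ?b (obs e z))
      + (?b (obs e z))\<^sup>2" for z
    by (simp add: power2_eq_square algebra_simps)
  then have "(\<integral>z. (e * fst z - f (obs e z))\<^sup>2 \<partial>joint)
      = (\<integral>z. (e * fst z - ?g z)\<^sup>2 \<partial>joint)
        - 2 * ((\<integral>z. e * fst z * ?b (obs e z) \<partial>joint) - (\<integral>z. ?g z * ?b (obs e z) \<partial>joint))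
        + (\<integral>z. (?b (obs e z))\<^sup>2 \<partial>joint)"
    using error cross(1,2) b by simp
  then show "(\<integral>z. (e * fst z - f (obs e z))\<^sup>2 \<partial>joint)
       = e\<^sup>2 * mmse \<nu> (e\<^sup>2) + (\<integral>z. (f (obs e z) - ?g z)\<^sup>2 \<partial>joint)"
    using cross(3) by (simp add: mmse_eq_post_mean_error[OF \<open>e > 0\<close>])
qed

end

subsection \<open>Asymptotic expansions at zero\<close>

definition has_expansion :: "(real \<Rightarrow> real) \<Rightarrow> real fps \<Rightarrow> bool" where
  "has_expansion f A \<longleftrightarrow>
     (\<forall>N. (\<lambda>e. f e - (\<Sum>n<N. fps_nth A n * e ^ n)) \<in> O[at_right 0](\<lambda>e. e ^ N))"

lemma bigo_power_at_right_0:
  assumes "m \<le> n"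
  shows "(\<lambda>e::real. e ^ n) \<in> O[at_right 0](\<lambda>e. e ^ m)"
proof (rule landau_o.bigI[of 1])
  show "\<forall>\<^sub>F e::real in at_right 0. norm (e ^ n) \<le> 1 * norm (e ^ m)"
    using eventually_at_right_real[of 0 1]
    by (rule eventually_mono) (use assms in \<open>auto simp: power_decreasing\<close>)
qed simp

lemma has_expansion_unique:
  assumes "has_expansion f A" "has_expansion g B" "\<And>e. e > 0 \<Longrightarrow> f e = g e"
  shows "A = B"
proof (rule fps_ext)
  fix n
  show "fps_nth A n = fps_nth B n"
  proof (induction n rule: less_induct)
    case (less n)
    let ?d = "fps_nth B n - fps_nth A n"
    let ?r = "\<lambda>f A e. f e - (\<Sum>i<Suc n. fps_nth A i * e ^ i)"
    have "\<forall>\<^sub>F e in at_right 0. ?r f A e - ?r g B e = ?d * e ^ n"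
      using eventually_at_right_less[of 0] by eventually_elim (simp add: assms(3) less algebra_simps)
    moreover have "(\<lambda>e. ?r f A e - ?r g B e) \<in> O[at_right 0](\<lambda>e. e ^ Suc n)"
      using assms(1,2) unfolding has_expansion_def by - (rule sum_in_bigo(2), blast+)
    ultimately have "(\<lambda>e. ?d * e ^ n) \<in> O[at_right 0](\<lambda>e. e * e ^ n)"
      by (simp add: landau_o.big.in_cong)
    moreover have "\<forall>\<^sub>F e::real in at_right 0. e ^ n \<noteq> 0"
      using eventually_at_right_less[of 0] by eventually_elim simp
    ultimately have "(\<lambda>_. ?d) \<in> O[at_right 0](\<lambda>e. e)"
      using landau_o.big.mult_cancel_right[of "\<lambda>e. e ^ n" "at_right 0" "\<lambda>e. e ^ n" "\<lambda>_. ?d" "\<lambda>e. e"] by simp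
    also have "(\<lambda>e. e) \<in> o[at_right 0](\<lambda>_. 1 :: real)"
      by (rule smalloI_tendsto) (auto intro!: tendsto_eq_intros)
    finally have "(\<lambda>_. ?d) \<in> o[at_right (0 :: real)](\<lambda>_. 1 :: real)" .
    then show ?case
      by (auto dest!: smalloD_tendsto simp: tendsto_const_iff)
  qed
qed

lemma has_expansion_poly: "has_expansion (poly q) (fps_of_poly q)"
  unfolding has_expansion_def
proof
  fix N
  have "poly q e - (\<Sum>n<N. fps_nth (fps_of_poly q) n * e ^ n) = e ^ N * poly (poly_shift N q) e" for e
  proof -
    have "q = (\<Sum>n<N. monom (coeff q n) n) + monom 1 N * poly_shift N q"
      by (rule poly_eqI) (simp add: coeff_sum coeff_poly_shift coeff_monom_mult)
    then have "poly q e = poly ((\<Sum>n<N. monom (coeff q n) n) + monom 1 N * poly_shift N q) e"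
      by (rule arg_cong)
    then show ?thesis by (simp add: poly_sum poly_monom)
  qed
  moreover have "poly (poly_shift N q) \<in> O[at_right 0](\<lambda>_. 1)"
    by (rule bigoI_tendsto[where c = "poly (poly_shift N q) 0"]) (auto intro!: tendsto_eq_intros)
  ultimately show "(\<lambda>e. poly q e - (\<Sum>n<N. fps_nth (fps_of_poly q) n * e ^ n)) \<in> O[at_right 0](\<lambda>e. e ^ N)"
    using landau_o.big.mult_left by fastforce
qed

lemma has_expansion_imp_bigo:
  assumes "has_expansion f A" "\<And>n. n < N \<Longrightarrow> fps_nth A n = 0"
  shows "f \<in> O[at_right 0](\<lambda>e. e ^ N)"
proof -
  have "(\<lambda>e. f e - (\<Sum>n<N. fps_nth A n * e ^ n)) \<in> O[at_right 0](\<lambda>e. e ^ N)"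
    using assms(1) by (simp add: has_expansion_def)
  then show ?thesis by (simp add: assms(2))
qed

lemma has_expansion_add:
  assumes "has_expansion f A" "has_expansion g B"
  shows "has_expansion (\<lambda>e. f e + g e) (A + B)"
  unfolding has_expansion_def
proof
  fix N
  have "(\<lambda>e. (f e - (\<Sum>n<N. fps_nth A n * e ^ n)) + (g e - (\<Sum>n<N. fps_nth B n * e ^ n)))
      \<in> O[at_right 0](\<lambda>e. e ^ N)"
    using assms unfolding has_expansion_def by - (rule sum_in_bigo(1), blast+)
  then show "(\<lambda>e. f e + g e - (\<Sum>n<N. fps_nth (A + B) n * e ^ n)) \<in> O[at_right 0](\<lambda>e. e ^ N)"
    by (simp add: distrib_right sum.distrib algebra_simps)
qed

lemma has_expansion_diff:
  assumes "has_expansion f A" "has_expansion g B"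
  shows "has_expansion (\<lambda>e. f e - g e) (A - B)"
  unfolding has_expansion_def
proof
  fix N
  have "(\<lambda>e. (f e - (\<Sum>n<N. fps_nth A n * e ^ n)) - (g e - (\<Sum>n<N. fps_nth B n * e ^ n)))
      \<in> O[at_right 0](\<lambda>e. e ^ N)"
    using assms unfolding has_expansion_def by - (rule sum_in_bigo(2), blast+)
  then show "(\<lambda>e. f e - g e - (\<Sum>n<N. fps_nth (A - B) n * e ^ n)) \<in> O[at_right 0](\<lambda>e. e ^ N)"
    by (simp add: left_diff_distrib sum_subtractf algebra_simps)
qed

subsection \<open>Asymptotic expansion of the minimum mean square error\<close>

lemma poly_higher_pderiv_expansion:
  fixes p :: "real poly"
  shows "poly p (t + y) = (\<Sum>j\<le>degree p. t ^ j / fact j * poly ((pderiv ^^ j) p) y)"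
proof -
  let ?D = "degree p"
  have deriv: "DERIV (\<lambda>s. poly ((pderiv ^^ m) p) (s + y)) s :> poly ((pderiv ^^ Suc m) p) (s + y)" for m s
    by (rule DERIV_cong[OF DERIV_chain2[OF poly_DERIV]]) (auto intro!: derivative_eq_intros)
  obtain u where "poly p (t + y) = (\<Sum>m<Suc ?D. poly ((pderiv ^^ m) p) (0 + y) / fact m * t ^ m)
      + poly ((pderiv ^^ Suc ?D) p) (u + y) / fact (Suc ?D) * t ^ Suc ?D"
    using Maclaurin_bi_le[of "\<lambda>m s. poly ((pderiv ^^ m) p) (s + y)" "\<lambda>s. poly p (s + y)" "Suc ?D" t] deriv
    by (auto simp del: funpow.simps(2) fact_Suc power_Suc)
  moreover have "(pderiv ^^ Suc ?D) p = 0"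
    by (simp add: pderiv_eq_0_iff degree_higher_pderiv)
  ultimately show ?thesis by (simp add: lessThan_Suc_atMost mult_ac)
qed

lemma integral_gaussian_poly_shift:
  "(\<integral>n. poly p (t + n) \<partial>gaussian) = (\<Sum>j\<le>degree p. t ^ j * gauss_ex (hermite j * p))"
proof -
  have "(\<integral>n. poly p (t + n) \<partial>gaussian)
      = (\<integral>n. (\<Sum>j\<le>degree p. t ^ j / fact j * poly ((pderiv ^^ j) p) n) \<partial>gaussian)"
    unfolding poly_higher_pderiv_expansion ..
  also have "\<dots> = (\<Sum>j\<le>degree p. t ^ j / fact j * gauss_ex ((pderiv ^^ j) p))"
    unfolding gauss_ex_def
    by (subst Bochner_Integration.integral_sum) (auto intro!: integrable_mult_right integrable_gaussian_poly)
  finally show ?thesis by (simp add: gauss_ex_higher_pderiv)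
qed

text \<open>From here on, a \<^typ>\<open>real poly poly\<close> is a polynomial in \<open>\<epsilon>\<close> whose coefficients are polynomials in \<open>y\<close>.\<close>

lemma poly_truncate_fps:
  fixes A :: "'a::comm_ring_1 fps"
  shows "poly (truncate_fps N A) x = (\<Sum>n<N. fps_nth A n * x ^ n)"
proof -
  have "truncate_fps N A = (\<Sum>n<N. monom (fps_nth A n) n)"
    by (rule poly_eqI) (simp add: coeff_truncate_fps coeff_sum)
  then show ?thesis by (simp add: poly_sum poly_monom)
qed

lemma abs_poly_poly_le_poly:
  fixes P :: "real poly poly"
  assumes "\<And>n. n < k \<Longrightarrow> coeff P n = 0"
  obtains h where "\<And>e y. 0 \<le> e \<Longrightarrow> e \<le> 1 \<Longrightarrow> \<bar>poly (poly P [:e:]) y\<bar> \<le> e ^ k * poly h y"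
proof -
  have "\<exists>h. \<forall>e y. 0 \<le> e \<longrightarrow> e \<le> 1 \<longrightarrow> \<bar>poly (poly Q [:e:]) y\<bar> \<le> poly h y" for Q :: "real poly poly"
  proof (induction Q)
    case (pCons p Q)
    then obtain h where h: "\<And>e y. 0 \<le> e \<Longrightarrow> e \<le> 1 \<Longrightarrow> \<bar>poly (poly Q [:e:]) y\<bar> \<le> poly h y" by blast
    obtain g where g: "\<And>u y. \<bar>u\<bar> \<le> 1 \<Longrightarrow> \<bar>poly p (y - u)\<bar> \<le> poly g y"
      using abs_poly_shift_le_poly[of p] by blast
    have "\<bar>poly (poly (pCons p Q) [:e:]) y\<bar> \<le> poly (g + h) y" if e: "0 \<le> e" "e \<le> 1" for e y
    proof -
      have "\<bar>e * poly (poly Q [:e:]) y\<bar> \<le> 1 * poly h y"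
        unfolding abs_mult using e h[OF e, of y] by (intro mult_mono) auto
      then show ?thesis
        using g[of 0 y] abs_triangle_ineq[of "poly p y" "e * poly (poly Q [:e:]) y"] by simp
    qed
    then show ?case by blast
  qed (auto intro: exI[of _ 0])
  then obtain h where h: "\<And>e y. 0 \<le> e \<Longrightarrow> e \<le> 1 \<Longrightarrow> \<bar>poly (poly (poly_shift k P) [:e:]) y\<bar> \<le> poly h y"
    by blast
  have "P = monom 1 k * poly_shift k P"
    by (rule poly_eqI) (simp add: coeff_monom_mult coeff_poly_shift assms)
  then have "poly (poly P [:e:]) y = poly (poly (monom 1 k * poly_shift k P) [:e:]) y" for e y
    by simp
  then have eq: "poly (poly P [:e:]) y = e ^ k * poly (poly (poly_shift k P) [:e:]) y" for e y
    by (simp add: poly_monom)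
  have "\<bar>poly (poly P [:e:]) y\<bar> \<le> e ^ k * poly h y" if e: "0 \<le> e" "e \<le> 1" for e y
    unfolding eq abs_mult using h[OF e] e by (intro mult_mono) auto
  then show thesis by (rule that)
qed

context moment_law
begin

lemma integrable_power_poly_obs:
  "integrable joint (\<lambda>z. fst z ^ i * snd z ^ l * poly p (obs e z))"
proof (induction p arbitrary: i l)
  case (pCons a p)
  have "integrable joint (\<lambda>z. a * (fst z ^ i * snd z ^ l)
      + (e * (fst z ^ Suc i * snd z ^ l * poly p (obs e z)) + fst z ^ i * snd z ^ Suc l * poly p (obs e z)))"
    by (intro Bochner_Integration.integrable_add integrable_mult_right integrable_joint_product
        integrable_power integrable_std_normal_distribution_moment pCons.IH)
  then show ?case by (simp add: algebra_simps)
qed simp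

lemma integrable_signal_power_poly_obs:
  "integrable joint (\<lambda>z. (e * fst z) ^ i * poly p (obs e z))"
  using integrable_mult_right[OF integrable_power_poly_obs[of i 0 p e], of "e ^ i"]
  by (simp add: power_mult_distrib mult.assoc)

lemma integral_signal_power_poly_obs:
  "(\<integral>z. (e * fst z) ^ i * poly p (obs e z) \<partial>joint)
     = (\<Sum>j\<le>degree p. e ^ (i + j) * moment \<nu> (i + j) * gauss_ex (hermite j * p))"
proof -
  have "(\<integral>z. (e * fst z) ^ i * poly p (obs e z) \<partial>joint)
      = (\<integral>x. (\<integral>n. (e * x) ^ i * poly p (e * x + n) \<partial>gaussian) \<partial>\<nu>)"
    using P.integral_fst'[OF integrable_signal_power_poly_obs[of e i p]] by simp
  also have "\<dots> = (\<integral>x. (\<Sum>j\<le>degree p. e ^ (i + j) * gauss_ex (hermite j * p) * x ^ (i + j)) \<partial>\<nu>)"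
    by (simp add: integral_gaussian_poly_shift sum_distrib_left power_mult_distrib power_add mult_ac)
  also have "\<dots> = (\<Sum>j\<le>degree p. e ^ (i + j) * moment \<nu> (i + j) * gauss_ex (hermite j * p))"
    unfolding moment_def by (subst Bochner_Integration.integral_sum) (simp_all add: mult_ac)
  finally show ?thesis .
qed

abbreviation density_fps :: "real poly fps" where
  "density_fps \<equiv> noisy_density (moment \<nu>)"

abbreviation mean_fps :: "real poly fps" where
  "mean_fps \<equiv> cond_mean (moment \<nu>)"

lemma integral_signal_power_poly_obs_eq_poly:
  "\<exists>r. (\<forall>e. (\<integral>z. (e * fst z) ^ i * poly p (obs e z) \<partial>joint) = poly r e)
     \<and> (\<forall>n. coeff r n = gauss_ex (fps_nth ((yderiv ^^ i) density_fps) n * p))"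
proof (intro exI conjI allI)
  define r where "r = (\<Sum>j\<le>degree p. monom (moment \<nu> (i + j) * gauss_ex (hermite j * p)) (i + j))"
  show "(\<integral>z. (e * fst z) ^ i * poly p (obs e z) \<partial>joint) = poly r e" for e
    by (simp add: integral_signal_power_poly_obs r_def poly_sum poly_monom mult_ac)
  show "coeff r n = gauss_ex (fps_nth ((yderiv ^^ i) density_fps) n * p)" for n
  proof -
    have "coeff r n = (\<Sum>j\<le>degree p. if i \<le> n \<and> j = n - i
        then moment \<nu> n * gauss_ex (hermite (n - i) * p) else 0)"
      unfolding r_def coeff_sum by (rule sum.cong) auto
    also have "\<dots> = (if i \<le> n then moment \<nu> n * gauss_ex (hermite (n - i) * p) else 0)"
      by (auto simp: not_le gauss_ex_hermite_eq_0)
    finally show ?thesis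
      by (simp add: higher_yderiv_noisy_density_nth gauss_ex_smult)
  qed
qed

lemma has_expansion_signal_power_poly_obs:
  "has_expansion (\<lambda>e. \<integral>z. (e * fst z) ^ i * poly (poly P [:e:]) (obs e z) \<partial>joint)
     (gauss_fps ((yderiv ^^ i) density_fps * fps_of_poly P))"
proof -
  let ?W = "(yderiv ^^ i) density_fps"
  let ?E = "\<lambda>P e. \<integral>z. (e * fst z) ^ i * poly (poly P [:e:]) (obs e z) \<partial>joint"
  have "\<exists>q. (\<forall>e. ?E P e = poly q e) \<and> gauss_fps (?W * fps_of_poly P) = fps_of_poly q"
  proof (induction P)
    case 0
    then show ?case by (intro exI[of _ 0]) (auto simp: fps_eq_iff)
  next
    case (pCons p P)
    then obtain q where q: "\<And>e. ?E P e = poly q e" "gauss_fps (?W * fps_of_poly P) = fps_of_poly q" by blast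
    obtain r where r: "\<And>e. (\<integral>z. (e * fst z) ^ i * poly p (obs e z) \<partial>joint) = poly r e"
        "\<And>n. coeff r n = gauss_ex (fps_nth ?W n * p)"
      using integral_signal_power_poly_obs_eq_poly[of i p] by blast
    have "?E (pCons p P) e = poly (r + pCons 0 q) e" for e
    proof -
      have "?E (pCons p P) e = (\<integral>z. (e * fst z) ^ i * poly p (obs e z)
          + e * ((e * fst z) ^ i * poly (poly P [:e:]) (obs e z)) \<partial>joint)"
        by (simp add: algebra_simps)
      also have "\<dots> = (\<integral>z. (e * fst z) ^ i * poly p (obs e z) \<partial>joint) + e * ?E P e"
        using integrable_signal_power_poly_obs by simp
      finally show ?thesis by (simp add: q(1) r(1))
    qed
    moreover have "gauss_fps (?W * fps_of_poly (pCons p P)) = fps_of_poly (r + pCons 0 q)"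
    proof (rule fps_ext)
      fix n
      have "gauss_ex (fps_nth (?W * fps_of_poly P) m) = coeff q m" for m
        using arg_cong[OF q(2), of "\<lambda>A. fps_nth A m"] by simp
      moreover have "?W * fps_of_poly (pCons p P) = ?W * fps_const p + fps_X * (?W * fps_of_poly P)"
        by (simp add: fps_of_poly_pCons algebra_simps)
      ultimately show "fps_nth (gauss_fps (?W * fps_of_poly (pCons p P))) n
          = fps_nth (fps_of_poly (r + pCons 0 q)) n"
        by (cases n) (simp_all add: gauss_ex_add r(2))
    qed
    ultimately show ?case by blast
  qed
  then obtain q where "\<And>e. ?E P e = poly q e" "gauss_fps (?W * fps_of_poly P) = fps_of_poly q" by blast
  then show ?thesis using has_expansion_poly[of q] by simp
qed

definition estimator :: "nat \<Rightarrow> real \<Rightarrow> real poly" where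
  "estimator M e = poly (truncate_fps M mean_fps) [:e:]"

lemma square_integrable_poly_obs: "integrable joint (\<lambda>z. (poly p (obs e z))\<^sup>2)"
  using integrable_signal_power_poly_obs[of e 0 "p * p"] by (simp add: power2_eq_square)

lemma integral_square_error_poly_obs:
  "(\<integral>z. (e * fst z - poly p (obs e z))\<^sup>2 \<partial>joint)
     = (\<integral>z. (e * fst z)\<^sup>2 \<partial>joint) - (\<integral>z. e * fst z * poly p (obs e z) \<partial>joint)
       - (\<integral>z. e * fst z * poly p (obs e z) \<partial>joint) + (\<integral>z. (poly p (obs e z))\<^sup>2 \<partial>joint)"
proof -
  have cross: "integrable joint (\<lambda>z. e * fst z * poly p (obs e z))"
    using integrable_signal_power_poly_obs[of e 1 p] by simp
  have "(\<integral>z. (e * fst z - poly p (obs e z))\<^sup>2 \<partial>joint)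
      = (\<integral>z. (e * fst z)\<^sup>2 - e * fst z * poly p (obs e z) - e * fst z * poly p (obs e z)
          + (poly p (obs e z))\<^sup>2 \<partial>joint)"
    by (simp add: power2_eq_square algebra_simps)
  also have "\<dots> = (\<integral>z. (e * fst z)\<^sup>2 \<partial>joint) - (\<integral>z. e * fst z * poly p (obs e z) \<partial>joint)
       - (\<integral>z. e * fst z * poly p (obs e z) \<partial>joint) + (\<integral>z. (poly p (obs e z))\<^sup>2 \<partial>joint)"
    using cross square_integrable_signal[of e] square_integrable_poly_obs[of p e]
    by (simp only: Bochner_Integration.integral_add Bochner_Integration.integral_diff
        Bochner_Integration.integrable_diff)
  finally show ?thesis .
qed

lemma has_expansion_estimator_error:
  obtains A where "has_expansion (\<lambda>e. \<integral>z. (e * fst z - poly (estimator M e) (obs e z))\<^sup>2 \<partial>joint) A"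
    and "\<And>n. n < 2 * M \<Longrightarrow> fps_nth A n = fps_nth (mmse_fps (moment \<nu>)) n"
proof
  let ?P = "truncate_fps M mean_fps" and ?F = "fps_cutoff M mean_fps" and ?W = density_fps
  let ?E = "\<lambda>i P e. \<integral>z. (e * fst z) ^ i * poly (poly P [:e:]) (obs e z) \<partial>joint"
  let ?A = "gauss_fps (yderiv (yderiv ?W) - yderiv ?W * ?F - yderiv ?W * ?F + ?W * (?F * ?F))"
  have "has_expansion (\<lambda>e. ?E 2 1 e - ?E 1 ?P e - ?E 1 ?P e + ?E 0 (?P * ?P) e) ?A"
    using has_expansion_signal_power_poly_obs[of 2 1] has_expansion_signal_power_poly_obs[of 1 ?P]
      has_expansion_signal_power_poly_obs[of 0 "?P * ?P"]
    unfolding gauss_fps_add gauss_fps_diff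
    by (intro has_expansion_add has_expansion_diff) (simp_all add: fps_of_poly_mult numeral_2_eq_2)
  then show "has_expansion (\<lambda>e. \<integral>z. (e * fst z - poly (estimator M e) (obs e z))\<^sup>2 \<partial>joint) ?A"
    unfolding integral_square_error_poly_obs by (simp add: estimator_def power2_eq_square)
  show "fps_nth ?A n = fps_nth (mmse_fps (moment \<nu>)) n" if "n < 2 * M" for n
    using mmse_fps_nth_cutoff[of "moment \<nu>", OF moment_0 that] .
qed

definition tilted_moment_Taylor :: "nat \<Rightarrow> real \<Rightarrow> nat \<Rightarrow> real \<Rightarrow> real" where
  "tilted_moment_Taylor M e i y = (\<Sum>j<M. e ^ (i + j) * moment \<nu> (i + j) * poly (hermite j) y)"

lemma poly_truncate_higher_yderiv_density:
  "poly (poly (truncate_fps (i + M) ((yderiv ^^ i) density_fps)) [:e:]) y = tilted_moment_Taylor M e i y"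
proof -
  have "poly (poly (truncate_fps (i + M) ((yderiv ^^ i) density_fps)) [:e:]) y
      = (\<Sum>n<i + M. poly (fps_nth ((yderiv ^^ i) density_fps) n) y * e ^ n)"
    by (simp add: poly_truncate_fps poly_sum poly_const_pow mult.commute)
  also have "\<dots> = (\<Sum>n\<in>{i..<i + M}. poly (fps_nth ((yderiv ^^ i) density_fps) n) y * e ^ n)"
    by (rule sum.mono_neutral_right) (auto simp: higher_yderiv_noisy_density_nth)
  also have "\<dots> = (\<Sum>j\<in>{0..<M}. poly (fps_nth ((yderiv ^^ i) density_fps) (i + j)) y * e ^ (i + j))"
    using sum.shift_bounds_nat_ivl[of "\<lambda>n. poly (fps_nth ((yderiv ^^ i) density_fps) n) y * e ^ n" 0 i M]
    by (simp add: add.commute)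
  finally show ?thesis
    by (simp add: higher_yderiv_noisy_density_nth tilted_moment_Taylor_def atLeast0LessThan mult_ac)
qed

lemma integrable_signal_power_mult_hermite_sum:
    "integrable \<nu> (\<lambda>x. (e * x) ^ i * (\<Sum>j<M. (e * x) ^ j * poly (hermite j) y))"
  and integral_signal_power_mult_hermite_sum:
    "(\<integral>x. (e * x) ^ i * (\<Sum>j<M. (e * x) ^ j * poly (hermite j) y) \<partial>\<nu>) = tilted_moment_Taylor M e i y"
proof -
  have eq: "(e * x) ^ i * (\<Sum>j<M. (e * x) ^ j * poly (hermite j) y)
      = (\<Sum>j<M. e ^ (i + j) * poly (hermite j) y * x ^ (i + j))" for x
    by (simp add: sum_distrib_left power_add power_mult_distrib mult_ac)
  show "integrable \<nu> (\<lambda>x. (e * x) ^ i * (\<Sum>j<M. (e * x) ^ j * poly (hermite j) y))"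
    unfolding eq by (intro Bochner_Integration.integrable_sum integrable_mult_right integrable_power)
  show "(\<integral>x. (e * x) ^ i * (\<Sum>j<M. (e * x) ^ j * poly (hermite j) y) \<partial>\<nu>) = tilted_moment_Taylor M e i y"
    unfolding eq moment_def tilted_moment_Taylor_def
    by (subst Bochner_Integration.integral_sum) (simp_all add: mult_ac)
qed

lemma tilted_moment_Taylor_error:
  obtains h where "\<And>e y. 0 \<le> e \<Longrightarrow> e \<le> 1 \<Longrightarrow>
    \<bar>tilted_moment e i y - tilted_moment_Taylor M e i y\<bar>
      \<le> e ^ M * (poly h y * exp \<bar>y\<bar>) + abs_tilted_moment e (i + M) y"
proof -
  obtain g where g: "\<And>e x y. 0 \<le> e \<Longrightarrow> e \<le> 1 \<Longrightarrow>
    \<bar>(e * x) ^ i * (tilt (e * x) y - (\<Sum>j<M. (e * x) ^ j * poly (hermite j) y))\<bar>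
      \<le> e ^ M * (poly g y * exp \<bar>y\<bar>) * \<bar>x\<bar> ^ (i + M) + \<bar>e * x\<bar> ^ (i + M) * tilt (e * x) y"
    using tilt_Taylor_scaled[of i M] by meson
  let ?h = "smult (\<integral>x. \<bar>x\<bar> ^ (i + M) \<partial>\<nu>) g"
  have "\<bar>tilted_moment e i y - tilted_moment_Taylor M e i y\<bar>
      \<le> e ^ M * (poly ?h y * exp \<bar>y\<bar>) + abs_tilted_moment e (i + M) y" if e: "0 \<le> e" "e \<le> 1" for e y
  proof -
    let ?T = "\<lambda>x. \<Sum>j<M. (e * x) ^ j * poly (hermite j) y" and ?c = "poly g y * exp \<bar>y\<bar>"
    have int: "integrable \<nu> (\<lambda>x. (e * x) ^ i * (tilt (e * x) y - ?T x))"
      unfolding right_diff_distrib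
      by (rule Bochner_Integration.integrable_diff[OF integrable_power_mult_tilt
          integrable_signal_power_mult_hermite_sum])
    have "tilted_moment e i y - tilted_moment_Taylor M e i y = (\<integral>x. (e * x) ^ i * (tilt (e * x) y - ?T x) \<partial>\<nu>)"
      unfolding right_diff_distrib integral_signal_power_mult_hermite_sum[symmetric] tilted_moment_def
      by (rule Bochner_Integration.integral_diff[symmetric])
        (rule integrable_power_mult_tilt integrable_signal_power_mult_hermite_sum)+
    then have "\<bar>tilted_moment e i y - tilted_moment_Taylor M e i y\<bar>
        = norm (\<integral>x. (e * x) ^ i * (tilt (e * x) y - ?T x) \<partial>\<nu>)"
      by simp
    also have "\<dots> \<le> (\<integral>x. e ^ M * ?c * \<bar>x\<bar> ^ (i + M) + \<bar>e * x\<bar> ^ (i + M) * tilt (e * x) y \<partial>\<nu>)"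
    proof (rule Bochner_Integration.integral_norm_bound_integral[OF int])
      show "integrable \<nu> (\<lambda>x. e ^ M * ?c * \<bar>x\<bar> ^ (i + M) + \<bar>e * x\<bar> ^ (i + M) * tilt (e * x) y)"
        by (intro Bochner_Integration.integrable_add integrable_mult_right integrable_abs_power
            integrable_abs_power_mult_tilt)
    qed (use g[OF e] in simp)
    also have "\<dots> = (\<integral>x. e ^ M * ?c * \<bar>x\<bar> ^ (i + M) \<partial>\<nu>) + abs_tilted_moment e (i + M) y"
      unfolding abs_tilted_moment_def
      by (intro Bochner_Integration.integral_add integrable_mult_right integrable_abs_power
          integrable_abs_power_mult_tilt)
    also have "(\<integral>x. e ^ M * ?c * \<bar>x\<bar> ^ (i + M) \<partial>\<nu>) = e ^ M * (poly ?h y * exp \<bar>y\<bar>)"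
      unfolding integral_mult_right_zero by simp
    finally show ?thesis .
  qed
  then show thesis by (rule that)
qed

lemma estimator_equation_bound:
  obtains h where "\<And>e y. 0 \<le> e \<Longrightarrow> e \<le> 1 \<Longrightarrow>
    \<bar>poly (estimator M e) y * tilted_moment_Taylor M e 0 y - tilted_moment_Taylor M e 1 y\<bar> \<le> e ^ M * poly h y"
proof -
  define P where "P = truncate_fps M mean_fps * truncate_fps M density_fps
      - truncate_fps (Suc M) (yderiv density_fps)"
  have "coeff P n = 0" if "n < M" for n
  proof -
    have "coeff (truncate_fps M mean_fps * truncate_fps M density_fps) n = fps_nth (mean_fps * density_fps) n"
      unfolding coeff_mult fps_mult_nth atLeast0AtMost using that by (intro sum.cong) auto
    also have "\<dots> = fps_nth (yderiv density_fps) n"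
      using noisy_density_mult_cond_mean[of "moment \<nu>", OF moment_0] by (simp add: mult.commute)
    finally show ?thesis using that by (simp add: P_def)
  qed
  then obtain h where h: "\<And>e y. 0 \<le> e \<Longrightarrow> e \<le> 1 \<Longrightarrow> \<bar>poly (poly P [:e:]) y\<bar> \<le> e ^ M * poly h y"
    using abs_poly_poly_le_poly[of M P] by blast
  have "poly (poly P [:e:]) y
      = poly (estimator M e) y * tilted_moment_Taylor M e 0 y - tilted_moment_Taylor M e 1 y" for e y
    using poly_truncate_higher_yderiv_density[of 0 M e y] poly_truncate_higher_yderiv_density[of 1 M e y]
    by (simp add: P_def estimator_def)
  with h show thesis by (intro that) simp
qed

lemma estimator_minus_post_mean_pointwise:
  obtains h q where "\<And>e y. 0 \<le> e \<Longrightarrow> e \<le> 1 \<Longrightarrow>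
    \<bar>tilted_moment e 0 y * (poly (estimator M e) y - post_mean e y)\<bar>
      \<le> e ^ M * (poly q y * exp \<bar>y\<bar>) + poly h y * abs_tilted_moment e M y + abs_tilted_moment e (Suc M) y"
proof -
  obtain r where r: "\<And>e y. 0 \<le> e \<Longrightarrow> e \<le> 1 \<Longrightarrow>
    \<bar>poly (estimator M e) y * tilted_moment_Taylor M e 0 y - tilted_moment_Taylor M e 1 y\<bar> \<le> e ^ M * poly r y"
    using estimator_equation_bound[of M] by blast
  obtain h where h: "\<And>e y. 0 \<le> e \<Longrightarrow> e \<le> 1 \<Longrightarrow> \<bar>poly (estimator M e) y\<bar> \<le> poly h y"
    using abs_poly_poly_le_poly[of 0 "truncate_fps M mean_fps"] unfolding estimator_def by auto
  obtain g0 where g0: "\<And>e y. 0 \<le> e \<Longrightarrow> e \<le> 1 \<Longrightarrow> \<bar>tilted_moment e 0 y - tilted_moment_Taylor M e 0 y\<bar>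
      \<le> e ^ M * (poly g0 y * exp \<bar>y\<bar>) + abs_tilted_moment e (0 + M) y"
    using tilted_moment_Taylor_error[of 0 M] by meson
  obtain g1 where g1: "\<And>e y. 0 \<le> e \<Longrightarrow> e \<le> 1 \<Longrightarrow> \<bar>tilted_moment e 1 y - tilted_moment_Taylor M e 1 y\<bar>
      \<le> e ^ M * (poly g1 y * exp \<bar>y\<bar>) + abs_tilted_moment e (1 + M) y"
    using tilted_moment_Taylor_error[of 1 M] by meson
  have "\<bar>tilted_moment e 0 y * (poly (estimator M e) y - post_mean e y)\<bar>
      \<le> e ^ M * (poly (r + h * g0 + g1) y * exp \<bar>y\<bar>) + poly h y * abs_tilted_moment e M y
          + abs_tilted_moment e (Suc M) y"
    if e: "0 \<le> e" "e \<le> 1" for e y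
  proof -
    let ?f = "poly (estimator M e) y" and ?T = "\<lambda>i. tilted_moment e i y"
      and ?S = "\<lambda>i. tilted_moment_Taylor M e i y"
    have "?T 0 * (?f - post_mean e y) = (?f * ?S 0 - ?S 1) + ?f * (?T 0 - ?S 0) - (?T 1 - ?S 1)"
      unfolding tilted_moment_0_mult_post_mean[symmetric] by (simp only: algebra_simps)
    then have "\<bar>?T 0 * (?f - post_mean e y)\<bar> \<le> \<bar>?f * ?S 0 - ?S 1\<bar> + \<bar>?f\<bar> * \<bar>?T 0 - ?S 0\<bar> + \<bar>?T 1 - ?S 1\<bar>"
      unfolding abs_mult[symmetric] by linarith
    also have "\<dots> \<le> e ^ M * (poly r y * exp \<bar>y\<bar>)
        + poly h y * (e ^ M * (poly g0 y * exp \<bar>y\<bar>) + abs_tilted_moment e (0 + M) y)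
        + (e ^ M * (poly g1 y * exp \<bar>y\<bar>) + abs_tilted_moment e (1 + M) y)"
    proof (intro add_mono mult_mono h[OF e] g0[OF e] g1[OF e])
      have "0 \<le> poly r y" using r[of 1 y] by simp
      then have "e ^ M * (poly r y * 1) \<le> e ^ M * (poly r y * exp \<bar>y\<bar>)"
        using e by (intro mult_left_mono) auto
      then show "\<bar>?f * ?S 0 - ?S 1\<bar> \<le> e ^ M * (poly r y * exp \<bar>y\<bar>)"
        using r[OF e, of y] by simp
      show "0 \<le> poly h y" using h[OF e, of y] by linarith
    qed simp
    also have "\<dots> = e ^ M * (poly (r + h * g0 + g1) y * exp \<bar>y\<bar>) + poly h y * abs_tilted_moment e M y
        + abs_tilted_moment e (Suc M) y"
      by (simp add: algebra_simps)
    finally show ?thesis .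
  qed
  then show thesis by (rule that)
qed

lemma exp_abs_square_le_tilted_moment_0:
  assumes e: "0 \<le> e" "e \<le> 1"
  shows "(exp \<bar>y\<bar>)\<^sup>2 \<le> tilted_moment e 0 y * (exp (moment \<nu> 2 / 2) * exp ((2 + \<bar>moment \<nu> 1\<bar>) * \<bar>y\<bar>))"
proof -
  let ?m = "\<bar>moment \<nu> 1\<bar> * \<bar>y\<bar>" and ?L = "exp (moment \<nu> 2 / 2) * exp ((2 + \<bar>moment \<nu> 1\<bar>) * \<bar>y\<bar>)"
  have "e * ?m \<le> 1 * ?m" "e\<^sup>2 * moment \<nu> 2 \<le> 1 * moment \<nu> 2"
    using e moment_2_nonneg power_le_one[of e 2] by (intro mult_right_mono; simp)+
  moreover have "- (e * ?m) \<le> e * y * moment \<nu> 1"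
    using abs_ge_minus_self[of "e * y * moment \<nu> 1"] e by (simp add: abs_mult mult_ac)
  ultimately have "- ?m - moment \<nu> 2 / 2 \<le> e * y * moment \<nu> 1 - e\<^sup>2 * moment \<nu> 2 / 2"
    by linarith
  then have "exp (- ?m - moment \<nu> 2 / 2) \<le> tilted_moment e 0 y"
    using tilted_moment_0_ge[of e y] by (meson exp_le_cancel_iff order_trans)
  then have "exp (- ?m - moment \<nu> 2 / 2) * ?L \<le> tilted_moment e 0 y * ?L"
    by (rule mult_right_mono) simp
  also have "exp (- ?m - moment \<nu> 2 / 2) * ?L = (exp \<bar>y\<bar>)\<^sup>2"
    unfolding power2_eq_square exp_add[symmetric] by (simp add: algebra_simps)
  finally show ?thesis .
qed

text \<open>The terms with tilted moments are squared by Cauchy-Schwarz against the tilted law, the first one by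
  the lower bound on its total mass.\<close>

lemma estimator_minus_post_mean_square_pointwise:
  obtains h q c where "\<And>e y. 0 \<le> e \<Longrightarrow> e \<le> 1 \<Longrightarrow>
    (poly (estimator M e) y - post_mean e y)\<^sup>2 * tilted_moment e 0 y
      \<le> 3 * (e ^ (2 * M) * (poly q y * exp (c * \<bar>y\<bar>)) + poly h y * tilted_moment e (2 * M) y
          + tilted_moment e (2 * Suc M) y)"
proof -
  obtain h q where hq: "\<And>e y. 0 \<le> e \<Longrightarrow> e \<le> 1 \<Longrightarrow>
    \<bar>tilted_moment e 0 y * (poly (estimator M e) y - post_mean e y)\<bar>
      \<le> e ^ M * (poly q y * exp \<bar>y\<bar>) + poly h y * abs_tilted_moment e M y + abs_tilted_moment e (Suc M) y"
    using estimator_minus_post_mean_pointwise[of M] by meson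
  define L where "L = exp (moment \<nu> 2 / 2)"
  define c where "c = 2 + \<bar>moment \<nu> 1\<bar>"
  have "(poly (estimator M e) y - post_mean e y)\<^sup>2 * tilted_moment e 0 y
      \<le> 3 * (e ^ (2 * M) * (poly (smult L (q * q)) y * exp (c * \<bar>y\<bar>))
          + poly (h * h) y * tilted_moment e (2 * M) y
          + tilted_moment e (2 * Suc M) y)"
    if e: "0 \<le> e" "e \<le> 1" for e y
  proof -
    let ?Z = "tilted_moment e 0 y" and ?b = "poly (estimator M e) y - post_mean e y"
    let ?u = "e ^ M * (poly q y * exp \<bar>y\<bar>)" and ?v = "poly h y * abs_tilted_moment e M y"
      and ?w = "abs_tilted_moment e (Suc M) y"
    have Z: "?Z > 0" by (rule tilted_moment_0_pos)
    have "(?Z * ?b)\<^sup>2 \<le> (?u + ?v + ?w)\<^sup>2"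
      by (rule abs_le_square_iff[THEN iffD1]) (use hq[OF e, of y] in linarith)
    also have "\<dots> \<le> 3 * (?u\<^sup>2 + ?v\<^sup>2 + ?w\<^sup>2)"
      using sum_squares_bound[of ?u ?v] sum_squares_bound[of ?u ?w] sum_squares_bound[of ?v ?w]
      by (simp add: power2_sum algebra_simps)
    also have "?u\<^sup>2 \<le> ?Z * (e ^ (2 * M) * (poly (smult L (q * q)) y * exp (c * \<bar>y\<bar>)))"
      using mult_left_mono[OF exp_abs_square_le_tilted_moment_0[OF e, of y]
          zero_le_power2[of "e ^ M * poly q y"]]
      unfolding power_even_eq L_def[symmetric] c_def[symmetric]
      by (simp add: power_mult_distrib power2_eq_square mult_ac)
    also have "?v\<^sup>2 \<le> ?Z * (poly (h * h) y * tilted_moment e (2 * M) y)"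
      using mult_left_mono[OF abs_tilted_moment_square_le[of e M y] zero_le_power2[of "poly h y"]]
      by (simp add: power_mult_distrib power2_eq_square mult_ac)
    also have "?w\<^sup>2 \<le> ?Z * tilted_moment e (2 * Suc M) y"
      by (rule abs_tilted_moment_square_le)
    finally have "?Z * (?b\<^sup>2 * ?Z) \<le> ?Z * (3 * (e ^ (2 * M) * (poly (smult L (q * q)) y * exp (c * \<bar>y\<bar>))
        + poly (h * h) y * tilted_moment e (2 * M) y + tilted_moment e (2 * Suc M) y))"
      by (simp add: power2_eq_square algebra_simps)
    then show ?thesis using Z by simp
  qed
  then show thesis by (rule that)
qed

lemma estimator_minus_post_mean_integral_le:
  obtains h K where "\<And>e. 0 < e \<Longrightarrow> e \<le> 1 \<Longrightarrow>
    (\<integral>z. (poly (estimator M e) (obs e z) - post_mean e (obs e z))\<^sup>2 \<partial>joint)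
      \<le> 3 * (e ^ (2 * M) * K + (\<integral>z. (e * fst z) ^ (2 * M) * poly h (obs e z) \<partial>joint)
          + (\<integral>z. (e * fst z) ^ (2 * Suc M) * poly 1 (obs e z) \<partial>joint))"
proof -
  obtain h q c where bound: "\<And>e y. 0 \<le> e \<Longrightarrow> e \<le> 1 \<Longrightarrow>
    (poly (estimator M e) y - post_mean e y)\<^sup>2 * tilted_moment e 0 y
      \<le> 3 * (e ^ (2 * M) * (poly q y * exp (c * \<bar>y\<bar>)) + poly h y * tilted_moment e (2 * M) y
          + tilted_moment e (2 * Suc M) y)"
    using estimator_minus_post_mean_square_pointwise[of M] by meson
  let ?E = "\<lambda>i p e. \<integral>z. (e * fst z) ^ i * poly p (obs e z) \<partial>joint"
  define K where "K = (\<integral>y. poly q y * exp (c * \<bar>y\<bar>) \<partial>gaussian)"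
  have "(\<integral>z. (poly (estimator M e) (obs e z) - post_mean e (obs e z))\<^sup>2 \<partial>joint)
      \<le> 3 * (e ^ (2 * M) * K + ?E (2 * M) h e + ?E (2 * Suc M) 1 e)" if e: "0 < e" "e \<le> 1" for e
  proof -
    let ?b = "\<lambda>y. (poly (estimator M e) y - post_mean e y)\<^sup>2"
    let ?G = "\<lambda>y. 3 * (e ^ (2 * M) * (poly q y * exp (c * \<bar>y\<bar>)) + poly h y * tilted_moment e (2 * M) y
        + poly 1 y * tilted_moment e (2 * Suc M) y)"
    have tilted: "integrable gaussian (\<lambda>y. poly p y * tilted_moment e i y)"
      "(\<integral>y. poly p y * tilted_moment e i y \<partial>gaussian) = ?E i p e" for p i
      using integrable_mult_tilted_moment[of "poly p" e i] integral_mult_tilted_moment[of "poly p" e i]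
        integrable_signal_power_poly_obs[of e i p] by simp_all
    have "integrable joint (\<lambda>z. ?b (obs e z))"
      by (rule mean_square_error_eq(1)[OF e(1) _ square_integrable_poly_obs]) measurable
    then have b: "integrable gaussian (\<lambda>y. ?b y * tilted_moment e 0 y)"
      "(\<integral>z. ?b (obs e z) \<partial>joint) = (\<integral>y. ?b y * tilted_moment e 0 y \<partial>gaussian)"
      using integrable_mult_tilted_moment[of ?b e 0] integral_mult_tilted_moment[of ?b e 0] by simp_all
    have "(\<integral>y. ?b y * tilted_moment e 0 y \<partial>gaussian) \<le> (\<integral>y. ?G y \<partial>gaussian)"
    proof (rule integral_mono[OF b(1)])
      show "integrable gaussian ?G"
        by (intro integrable_mult_right Bochner_Integration.integrable_add tilted
            integrable_gaussian_poly_mult_exp_abs)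
    qed (use bound[of e] e in simp)
    also have "\<dots> = 3 * (e ^ (2 * M) * K + ?E (2 * M) h e + ?E (2 * Suc M) 1 e)"
      using integrable_gaussian_poly_mult_exp_abs[of q c] tilted(1) by (simp add: K_def tilted(2) del: poly_1)
    finally show ?thesis unfolding b(2) .
  qed
  then show thesis by (rule that)
qed

lemma estimator_minus_post_mean_bigo:
  "(\<lambda>e. \<integral>z. (poly (estimator M e) (obs e z) - post_mean e (obs e z))\<^sup>2 \<partial>joint) \<in> O[at_right 0](\<lambda>e. e ^ (2 * M))"
proof -
  let ?D = "\<lambda>e. \<integral>z. (poly (estimator M e) (obs e z) - post_mean e (obs e z))\<^sup>2 \<partial>joint"
  let ?E = "\<lambda>i p e. \<integral>z. (e * fst z) ^ i * poly p (obs e z) \<partial>joint"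
  obtain h K where le: "\<And>e. 0 < e \<Longrightarrow> e \<le> 1 \<Longrightarrow>
      ?D e \<le> 3 * (e ^ (2 * M) * K + ?E (2 * M) h e + ?E (2 * Suc M) 1 e)"
    using estimator_minus_post_mean_integral_le[of M] by meson
  define B where "B e = 3 * (e ^ (2 * M) * K + ?E (2 * M) h e + ?E (2 * Suc M) 1 e)" for e
  have "?D e \<ge> 0" for e by simp
  then have "\<forall>\<^sub>F e in at_right 0. norm (?D e) \<le> norm (B e)"
    using eventually_at_right_real[of 0 1] le unfolding B_def[symmetric]
    by (auto elim!: eventually_mono intro!: order_trans[OF _ abs_ge_self])
  then have "?D \<in> O[at_right 0](B)"
    by (rule landau_o.big_mono)
  also have "B \<in> O[at_right 0](\<lambda>e. e ^ (2 * M))"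
  proof -
    have "?E i p \<in> O[at_right 0](\<lambda>e. e ^ (2 * M))" if "2 * M \<le> i" for i p
      using that has_expansion_signal_power_poly_obs[of i "[:p:]"]
      by (intro has_expansion_imp_bigo)
        (auto simp: fps_mult_nth higher_yderiv_noisy_density_nth fps_of_poly_const)
    moreover have "(\<lambda>e. e ^ (2 * M) * K) \<in> O[at_right 0](\<lambda>e. e ^ (2 * M))"
      by (rule bigoI[of _ "\<bar>K\<bar>"]) (simp add: abs_mult mult.commute)
    ultimately show ?thesis
      by (simp add: B_def[abs_def] sum_in_bigo(1) del: mult_Suc_right poly_1)
  qed
  finally show ?thesis .
qed

theorem has_expansion_mmse: "has_expansion (\<lambda>e. e\<^sup>2 * mmse \<nu> (e\<^sup>2)) (mmse_fps (moment \<nu>))"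
  unfolding has_expansion_def
proof
  fix M
  let ?f = "\<lambda>e z. poly (estimator M e) (obs e z)"
  let ?E = "\<lambda>e. \<integral>z. (e * fst z - ?f e z)\<^sup>2 \<partial>joint" and ?D = "\<lambda>e. \<integral>z. (?f e z - post_mean e (obs e z))\<^sup>2 \<partial>joint"
  obtain A where A: "has_expansion ?E A"
    and A_nth: "\<And>n. n < 2 * M \<Longrightarrow> fps_nth A n = fps_nth (mmse_fps (moment \<nu>)) n"
    using has_expansion_estimator_error[of M] by blast
  have "(\<lambda>e. ?E e - (\<Sum>n<M. fps_nth A n * e ^ n)) \<in> O[at_right 0](\<lambda>e. e ^ M)"
    using A by (simp add: has_expansion_def)
  moreover have "?D \<in> O[at_right 0](\<lambda>e. e ^ M)"
    by (rule landau_o.big_trans[OF estimator_minus_post_mean_bigo[of M] bigo_power_at_right_0]) simp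
  ultimately have "(\<lambda>e. ?E e - (\<Sum>n<M. fps_nth A n * e ^ n) - ?D e) \<in> O[at_right 0](\<lambda>e. e ^ M)"
    by (rule sum_in_bigo(2))
  moreover have "\<forall>\<^sub>F e in at_right 0. ?E e - (\<Sum>n<M. fps_nth A n * e ^ n) - ?D e
      = e\<^sup>2 * mmse \<nu> (e\<^sup>2) - (\<Sum>n<M. fps_nth (mmse_fps (moment \<nu>)) n * e ^ n)"
    using eventually_at_right_less[of 0]
  proof eventually_elim
    case (elim e)
    have "?E e = e\<^sup>2 * mmse \<nu> (e\<^sup>2) + ?D e"
      by (rule mean_square_error_eq(2)[OF elim _ square_integrable_poly_obs]) measurable
    then show ?case by (simp add: A_nth)
  qed
  ultimately show "(\<lambda>e. e\<^sup>2 * mmse \<nu> (e\<^sup>2) - (\<Sum>n<M. fps_nth (mmse_fps (moment \<nu>)) n * e ^ n))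
      \<in> O[at_right 0](\<lambda>e. e ^ M)"
    by (simp add: landau_o.big.in_cong)
qed

end

subsection \<open>Identification of the moments\<close>

lemma mmse_fps_nth_2:
  assumes "a 0 = 1" "a 1 = 0"
  shows "fps_nth (mmse_fps a) 2 = a 2"
proof -
  have "fps_nth (noisy_density a * (cond_mean a * cond_mean a)) 2 = 0"
    using assms by (simp add: fps_mult_nth numeral_2_eq_2 cond_mean_nth_0 cond_mean_nth_1)
  then show ?thesis
    using gauss_fps_yderiv2_noisy_density[of a 2] unfolding mmse_fps_def gauss_fps_diff fps_sub_nth by simp
qed

lemma cumulant_fps_nth_1:
  assumes "a 0 = 1" "a 1 = 0"
  shows "fps_nth (cumulant_fps a) 1 = a 2"
  using cumulant_fps_nth[of a 1] assms by (simp add: numeral_2_eq_2)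

lemma cumulant_fps_eq_0_if_odd_moments_eq_0:
  assumes "a 0 = 1" and odd: "\<And>i. odd i \<Longrightarrow> a i = 0" and "even n"
  shows "fps_nth (cumulant_fps a) n = 0"
  using \<open>even n\<close>
proof (induction n rule: less_induct)
  case (less n)
  have "(\<Sum>i = 1..n. a i / fact i * fps_nth (cumulant_fps a) (n - i)) = 0"
  proof (rule sum.neutral, rule ballI)
    fix i assume "i \<in> {1..n}"
    then show "a i / fact i * fps_nth (cumulant_fps a) (n - i) = 0"
      using less odd[of i] by (cases "odd i") auto
  qed
  then show ?case
    using cumulant_fps_nth[of a n, OF assms(1)] odd[of "Suc n"] less.prems by simp
qed

lemma cumulant_fps_cong:
  assumes "a 0 = 1" "b 0 = 1" "\<And>i. i \<le> Suc k \<Longrightarrow> b i = a i"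
  shows "fps_nth (cumulant_fps b) k = fps_nth (cumulant_fps a) k"
  using assms(3)
proof (induction k rule: less_induct)
  case (less k)
  have "(\<Sum>i = 1..k. b i / fact i * fps_nth (cumulant_fps b) (k - i))
      = (\<Sum>i = 1..k. a i / fact i * fps_nth (cumulant_fps a) (k - i))"
    using less by (intro sum.cong) auto
  then show ?case
    using cumulant_fps_nth[of a k, OF assms(1)] cumulant_fps_nth[of b k, OF assms(2)] less.prems by simp
qed

lemma cumulant_fps_diff:
  assumes "a 0 = 1" "b 0 = 1" "\<And>i. i \<le> k \<Longrightarrow> b i = a i"
  shows "fps_nth (cumulant_fps b) k = fps_nth (cumulant_fps a) k + (b (Suc k) - a (Suc k)) / fact k"
proof -
  have "(\<Sum>i = 1..k. b i / fact i * fps_nth (cumulant_fps b) (k - i))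
      = (\<Sum>i = 1..k. a i / fact i * fps_nth (cumulant_fps a) (k - i))"
    using assms cumulant_fps_cong[of a b] by (intro sum.cong) auto
  then show ?thesis
    using cumulant_fps_nth[of a k, OF assms(1)] cumulant_fps_nth[of b k, OF assms(2)]
    by (simp add: diff_divide_distrib)
qed

definition alternating :: "real fps \<Rightarrow> bool" where
  "alternating C \<longleftrightarrow> (\<forall>n. even n \<longrightarrow> fps_nth C n = 0) \<and> (\<forall>n. (- 1) ^ n * fps_nth C (2 * n + 1) > 0)"

lemma alternatingI:
  assumes even: "\<And>n. even n \<Longrightarrow> fps_nth C n = 0" and pos: "fps_nth C 1 > 0"
    and neg: "\<And>n. fps_nth C (2 * n + 1) * fps_nth C (2 * n + 3) < 0"
  shows "alternating C"
proof -
  have "(- 1) ^ n * fps_nth C (2 * n + 1) > 0" for n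
  proof (induction n)
    case (Suc n)
    have "((- 1) ^ n * fps_nth C (2 * n + 1)) * ((- 1) ^ n * fps_nth C (2 * n + 3))
        = fps_nth C (2 * n + 1) * fps_nth C (2 * n + 3)"
      by (simp add: mult_ac flip: power_mult_distrib)
    then have "(- 1) ^ n * fps_nth C (2 * n + 3) < 0"
      using Suc neg[of n] by (metis less_imp_le linorder_not_less mult_nonneg_nonneg)
    then show ?case by (simp add: numeral_3_eq_3)
  qed (use pos in simp)
  with even show ?thesis by (simp add: alternating_def)
qed

lemma alternating_mult_pos:
  assumes "alternating C" "u \<le> n"
  shows "fps_nth C (2 * n + 1) * (fps_nth C (2 * u + 1) * fps_nth C (2 * (n - u) + 1)) > 0"
proof -
  let ?c = "\<lambda>m. fps_nth C (2 * m + 1)"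
  have pos: "(- 1) ^ m * ?c m > 0" for m
    using assms(1) by (simp add: alternating_def)
  have "0 < ((- 1) ^ n * ?c n) * (((- 1) ^ u * ?c u) * ((- 1) ^ (n - u) * ?c (n - u)))"
    by (rule mult_pos_pos[OF pos mult_pos_pos[OF pos pos]])
  also have "\<dots> = (- 1) ^ (n + u + (n - u)) * (?c n * (?c u * ?c (n - u)))"
    unfolding power_add by (simp only: mult_ac)
  also have "n + u + (n - u) = 2 * n" using assms(2) by simp
  finally show ?thesis by simp
qed

lemma alternating_convolution_gt:
  assumes alt: "alternating C" and n: "2 \<le> n" and k: "k = 2 * n + 1"
  shows "fps_nth C k * fps_nth (C * C) (Suc k) > 2 * fps_nth C 1 * (fps_nth C k)\<^sup>2"
proof -
  let ?c = "fps_nth C"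
  let ?t = "\<lambda>i. ?c k * (?c i * ?c (Suc k - i))"
  have t_pos: "?t (2 * u + 1) > 0" if "u \<le> n" for u
  proof -
    have "Suc k - (2 * u + 1) = 2 * (n - u) + 1" using that by (simp add: k)
    then show ?thesis using alternating_mult_pos[OF alt that] k by (simp only:)
  qed
  have t_nonneg: "?t i \<ge> 0" if "i \<in> {0..Suc k}" for i
  proof (cases "even i")
    case True
    then show ?thesis using alt by (simp add: alternating_def)
  next
    case False
    then obtain u where "i = 2 * u + 1" by (auto elim: oddE)
    with that t_pos[of u] show ?thesis by (simp add: k)
  qed
  have "?t 1 + ?t 3 + ?t k = (\<Sum>i\<in>{1, 3, k}. ?t i)"
    using n k by simp
  also have "\<dots> \<le> (\<Sum>i = 0..Suc k. ?t i)"
    by (rule sum_mono2) (use t_nonneg n k in auto)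
  also have "\<dots> = ?c k * fps_nth (C * C) (Suc k)"
    unfolding fps_mult_nth sum_distrib_left ..
  finally have "?t 1 + ?t 3 + ?t k \<le> ?c k * fps_nth (C * C) (Suc k)" .
  moreover have "?t 1 = ?c 1 * (?c k)\<^sup>2" "?t k = ?c 1 * (?c k)\<^sup>2"
    by (simp_all add: power2_eq_square)
  moreover have "?t 3 > 0" using t_pos[of 1] n by (simp add: numeral_3_eq_3)
  ultimately show ?thesis by linarith
qed

context
  fixes a b :: "nat \<Rightarrow> real"
  assumes a: "a 0 = 1" "a 1 = 0" and b: "b 0 = 1" "b 1 = 0" and mmse: "mmse_fps a = mmse_fps b"
begin

lemma first_differing_cumulant_changes_sign:
  assumes "2 \<le> k" "\<And>i. i \<le> k \<Longrightarrow> b i = a i" "b (Suc k) \<noteq> a (Suc k)"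
  shows "(b (Suc k) - a (Suc k)) / fact k = - 2 * fps_nth (cumulant_fps a) k"
    and "fps_nth (cumulant_fps b) k = - fps_nth (cumulant_fps a) k"
    and "fps_nth (cumulant_fps a) k \<noteq> 0"
proof -
  have "(b (Suc k) - a (Suc k)) * (2 * fps_nth (cumulant_fps a) k + (b (Suc k) - a (Suc k)) / fact k) = 0"
    using mmse_fps_diff_nth_double[of a b k, OF a b assms(1,2)] mmse by simp
  with assms(3) show d: "(b (Suc k) - a (Suc k)) / fact k = - 2 * fps_nth (cumulant_fps a) k"
    by simp
  then show "fps_nth (cumulant_fps b) k = - fps_nth (cumulant_fps a) k"
    using cumulant_fps_diff[of a b k, OF a(1) b(1) assms(2)] by simp
  show "fps_nth (cumulant_fps a) k \<noteq> 0"
    using d assms(3) by auto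
qed

lemma alternating_imp_next_moment_eq:
  assumes alt: "alternating (cumulant_fps a)" and n: "2 \<le> n" and k: "k = 2 * n + 1"
    and agree: "\<And>i. i \<le> k \<Longrightarrow> b i = a i"
  shows "b (Suc k) = a (Suc k)"
proof (rule ccontr)
  let ?C = "cumulant_fps a"
  define d where "d = b (Suc k) - a (Suc k)"
  assume "b (Suc k) \<noteq> a (Suc k)"
  then have quot: "d / fact k = - 2 * fps_nth ?C k"
    using first_differing_cumulant_changes_sign(1)[of k] agree n k by (simp add: d_def)
  then have d: "d = - (2 * fact k * fps_nth ?C k)"
    by (simp add: field_simps)
  have "fps_nth ?C (Suc k) = 0" using alt k by (simp add: alternating_def)
  then have "(b (k + 2) - a (k + 2)) * ((b (k + 2) - a (k + 2)) / fact (Suc k))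
      = real (k + 2) * d * (fps_nth (?C * ?C) (Suc k) + a 2 * (d / fact k))"
    using mmse_fps_diff_nth_double_add_2[of a b k, OF a b _ agree] mmse n k by (simp add: d_def)
  also have "\<dots> = - (2 * fact k * real (k + 2)) * (fps_nth ?C k * fps_nth (?C * ?C) (Suc k)
      - 2 * fps_nth ?C 1 * (fps_nth ?C k)\<^sup>2)"
    unfolding quot cumulant_fps_nth_1[of a, OF a] unfolding d by (simp add: power2_eq_square algebra_simps)
  also have "\<dots> < 0"
    using alternating_convolution_gt[OF alt n k] by (intro mult_neg_pos) auto
  finally show False
    using divide_nonneg_pos[OF zero_le_square[of "b (k + 2) - a (k + 2)"] fact_gt_zero[of "Suc k"]]
    unfolding times_divide_eq_right by linarith
qed

lemma moments_eqI:
  assumes alt: "alternating (cumulant_fps a)"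
    and fourth: "fps_nth (cumulant_fps b) 3 * fps_nth (cumulant_fps a) 3 > 0"
  shows "b k = a k"
proof (induction k rule: less_induct)
  case (less k)
  consider "k \<le> 1" | "k = 2" | "3 \<le> k" by linarith
  then show ?case
  proof cases
    case 1
    then show ?thesis using a b by (cases k) auto
  next
    case 2
    then show ?thesis using mmse mmse_fps_nth_2[of a, OF a] mmse_fps_nth_2[of b, OF b] by simp
  next
    case 3
    then obtain j where j: "k = Suc j" "2 \<le> j" by (cases k) auto
    then have agree: "b i = a i" if "i \<le> j" for i using less that by simp
    show ?thesis
    proof (rule ccontr)
      assume ne: "b k \<noteq> a k"
      note flip = first_differing_cumulant_changes_sign[OF j(2) agree ne[unfolded j(1)]]
      then have "odd j" using alt by (auto simp: alternating_def)
      then obtain n where n: "j = 2 * n + 1" by (auto elim: oddE)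
      with j(2) consider "n = 1" | "2 \<le> n" by fastforce
      then show False
      proof cases
        case 1
        then show ?thesis using flip(2) fourth n by (simp add: not_less flip: power2_eq_square)
      next
        case 2
        then show ?thesis using alternating_imp_next_moment_eq[OF alt 2 n agree] ne j(1) by simp
      qed
    qed
  qed
qed

end

subsection \<open>Symmetric moment-determined laws\<close>

lemma mmse_eq_imp_mmse_fps_eq:
  assumes "moment_law \<mu>" "moment_law \<nu>" and mmse: "\<And>s. s > 0 \<Longrightarrow> mmse \<mu> s = mmse \<nu> s"
  shows "mmse_fps (moment \<mu>) = mmse_fps (moment \<nu>)"
proof (rule has_expansion_unique)
  show "has_expansion (\<lambda>e. e\<^sup>2 * mmse \<mu> (e\<^sup>2)) (mmse_fps (moment \<mu>))"
    using assms(1) by (rule moment_law.has_expansion_mmse)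
  show "has_expansion (\<lambda>e. e\<^sup>2 * mmse \<nu> (e\<^sup>2)) (mmse_fps (moment \<nu>))"
    using assms(2) by (rule moment_law.has_expansion_mmse)
qed (simp add: mmse)

lemma moment_law_distr:
  assumes "prob_space M" and Y [measurable]: "Y \<in> borel_measurable M"
    and "\<And>n::nat. integrable M (\<lambda>\<omega>. Y \<omega> ^ n)"
  shows "moment_law (distr M borel Y)"
  using prob_space.prob_space_distr[OF assms(1,2)] assms(3)
  by (simp add: moment_law_def moment_law_axioms_def integrable_distr_eq)

lemma SMD_imp_moment_law: "SMD \<mu> \<Longrightarrow> moment_law \<mu>"
  by (simp add: SMD_def real_law_def all_moments_def moment_law_def moment_law_axioms_def)

lemma SMD_eqI:
  assumes "SMD \<mu>" "moment_law \<nu>" "\<And>k. moment \<nu> k = moment \<mu> k"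
  shows "\<nu> = \<mu>"
proof -
  interpret moment_law \<nu> by fact
  have "real_law \<nu>" by (simp add: real_law_def prob_space_axioms)
  with assms(1,3) show ?thesis unfolding SMD_def moment_def by simp
qed

lemma symmetric_odd_moment_eq_0:
  assumes "moment_law \<nu>" "distr \<nu> borel uminus = \<nu>" "odd n"
  shows "moment \<nu> n = 0"
proof -
  interpret moment_law \<nu> by fact
  have "moment \<nu> n = (\<integral>x. x ^ n \<partial>distr \<nu> borel uminus)"
    by (simp add: moment_def assms(2))
  also have "\<dots> = (\<integral>x. (- x) ^ n \<partial>\<nu>)"
    by (rule integral_distr) simp_all
  also have "\<dots> = - moment \<nu> n"
    using assms(3) by (simp add: moment_def)
  finally show ?thesis by simp
qed

lemma SMD_alternating:
  assumes "SMD \<mu>" and neg: "\<And>n::nat. n \<ge> 1 \<Longrightarrow> cumulant \<mu> (2 * n) * cumulant \<mu> (2 * n + 2) < 0"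
  shows "moment \<mu> 1 = 0" "alternating (cumulant_fps (moment \<mu>))"
proof -
  interpret moment_law \<mu> using assms(1) by (rule SMD_imp_moment_law)
  let ?C = "cumulant_fps (moment \<mu>)"
  have odd: "moment \<mu> n = 0" if "odd n" for n
    using symmetric_odd_moment_eq_0[OF moment_law_axioms _ that] assms(1) by (simp add: SMD_def)
  then show mean: "moment \<mu> 1 = 0" by simp
  have neg: "fps_nth ?C (2 * n + 1) * fps_nth ?C (2 * n + 3) < 0" for n
    using neg[of "Suc n"] cumulant_Suc[of "2 * n + 1"] cumulant_Suc[of "2 * n + 3"]
    by (simp add: mult_less_0_iff zero_less_mult_iff numeral_3_eq_3)
  show "alternating ?C"
  proof (rule alternatingI)
    have "fps_nth ?C 1 \<ge> 0"
      using cumulant_fps_nth_1[of "moment \<mu>", OF moment_0 mean] moment_2_nonneg by simp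
    then show "fps_nth ?C 1 > 0" using neg[of 0] by (cases "fps_nth ?C 1 = 0") auto
  qed (use neg odd in \<open>auto intro: cumulant_fps_eq_0_if_odd_moments_eq_0\<close>)
qed

theorem theorem2p9:
  fixes M :: "'a measure" and X :: "'a \<Rightarrow> real"
    and M' :: "'b measure" and Y :: "'b \<Rightarrow> real"
  assumes "prob_space M" and "X \<in> borel_measurable M"
    and "prob_space M'" and "Y \<in> borel_measurable M'"
    and "SMD (distr M borel X)"
    and "\<And>n::nat. n \<ge> 1 \<Longrightarrow>
           cumulant (distr M borel X) (2*n) * cumulant (distr M borel X) (2*n+2) < 0"
    and "\<And>n::nat. integrable M' (\<lambda>\<omega>. Y \<omega> ^ n)"
    and "(\<integral>\<omega>. Y \<omega> \<partial>M') = 0"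
    and "cumulant (distr M' borel Y) 4 * cumulant (distr M borel X) 4 > 0"
    and "\<And>s::real. s > 0 \<Longrightarrow> mmse (distr M borel X) s = mmse (distr M' borel Y) s"
  shows "distr M borel X = distr M' borel Y"
proof -
  let ?\<mu> = "distr M borel X" and ?\<nu> = "distr M' borel Y"
  interpret X: moment_law ?\<mu> using assms(5) by (rule SMD_imp_moment_law)
  interpret Y: moment_law ?\<nu> using assms(3,4,7) by (rule moment_law_distr)
  have "mmse_fps (moment ?\<mu>) = mmse_fps (moment ?\<nu>)"
    using X.moment_law_axioms Y.moment_law_axioms assms(10) by (rule mmse_eq_imp_mmse_fps_eq)
  moreover have "moment ?\<nu> 1 = 0"
    using assms(4,8) by (simp add: moment_def integral_distr)
  moreover note SMD_alternating[OF assms(5,6)]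
  moreover have "fps_nth (cumulant_fps (moment ?\<nu>)) 3 * fps_nth (cumulant_fps (moment ?\<mu>)) 3 > 0"
    using assms(9) X.cumulant_Suc[of 3] Y.cumulant_Suc[of 3] by (simp add: zero_less_mult_iff mult_less_0_iff)
  ultimately have "moment ?\<nu> k = moment ?\<mu> k" for k
    using moments_eqI X.moment_0 Y.moment_0 by blast
  then show ?thesis
    using SMD_eqI[OF assms(5) Y.moment_law_axioms] by simp
qed

end
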